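(* Let $m\ge1$, let $k$ be an odd number with $1\le k\le m$ and let $R_m$ be a generic $m$-rosette. Then $$\int_{\Sigma_k}\kappa_{k,s}\,d\tau+\int_{\{1\}\times S^1}\hat\kappa_{k,g}\,d\tau=0,$$ where $d\tau$ denotes the arc length measure, $\Sigma_k$ is the singular set of the front $f_k$ on $M=[0,1]\times S^1$, $\kappa_{k,s}$ is its singular curvature, $\hat\kappa_{k,g}$ is the $\mathcal E^{f_k}$-geodesic curvature, and the orientation of $\{1\}\times S^1$ is compatible with the orientation of $M$.
   Context: An $m$-rosette $R_m$ is a closed regular smooth curve in $\mathbb R^2$ with positive signed curvature and rotation number $m$. With its $2m\pi$-periodic support function $p$ it is parametrized by $\gamma(\theta)=(p(\theta)\cos\theta-p'(\theta)\sin\theta,\;p(\theta)\sin\theta+p'(\theta)\cos\theta)$; its radius of curvature is $\rho=p+p''>0$ and its curvature is $\kappa=1/\rho$. "Generic" has its usual meaning in singularity theory: the assertion holds for all $R_m$ in some residual subset of the space of $m$-rosettes with the $C^\infty$ topology. Put $S^1=\mathbb R/2m\pi\mathbb Z$ and $M=[0,1]\times S^1$, oriented by $(\lambda,\theta)$. Let $f_k:M\to\mathbb R^3$, $f_k(\lambda,\theta)=(\lambda,\lambda\gamma(\theta)+(1-\lambda)\gamma(\theta+k\pi))$ (a branch of the affine extended wave front of $R_m$), $w_k(\theta)=p(\theta)-(-1)^kp(\theta+k\pi)$ (the $k$-width), $\mathbf n(\theta)=-(\cos\theta,\sin\theta)$, and $\nu_k(\lambda,\theta)=(w_k(\theta),\mathbf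 n(\theta))/\sqrt{1+w_k^2(\theta)}\in S^2$, a unit normal of $f_k$. For odd $k$, the map $(f_k,\nu_k)$ is a front and defines a coherent tangent bundle $\mathcal E^{f_k}$ over $M$: the fiber at $q$ is $\{X\in T_{f_k(q)}\mathbb R^3:\langle X,\nu_k(q)\rangle=0\}$, with the induced Euclidean metric, $D$ the orthogonal projection of the Euclidean derivative to $\mathcal E^{f_k}$, $\psi=df_k$, and co-orientation $\mu(X,Y)=\det(X,Y,\nu_k)$. The singular set is $\Sigma_k=\{(\lambda_k(\theta),\theta)\}$ with $\lambda_k(\theta)=\kappa(\theta)/(\kappa(\theta)+\kappa(\theta+k\pi))$. Arc length is taken with respect to $ds^2=f_k^*\langle\cdot,\cdot\rangle$. For a curve $\sigma$ with $\psi(\dot\sigma)\ne0$, $\hat\kappa_{k,g}=\mu(\psi(\dot\sigma),D_{d/dt}\psi(\dot\sigma))/|\psi(\dot\sigma)|^3$. Put $\lambda_\psi=\mu((f_k)_\lambda,(f_k)_\theta)$. At points of the singular curve $\sigma$ where the null direction (the kernel of $df_k$) is transversal to $\dot\sigma$, let $\eta$ be a null vector field with $\{\dot\sigma,\eta\}$ positively oriented; the singular curvature is $\kappa_{k,s}=\mathrm{sgn}(d\lambda_\psi(\eta))\,\hat\kappa_{k,g}$, where $\hat\kappa_{k,g}$ is computed along $\sigma$. *)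

theory Defs
  imports "HOL-Analysis.Analysis"
begin

section \<open>Rosettes\<close>

text \<open>
  A closed curve is a map on \<open>\<real>/\<int>\<close>, given as a 1-periodic map on \<open>\<real>\<close>.
\<close>

definition vderiv :: "nat \<Rightarrow> (real \<Rightarrow> 'a::real_normed_vector) \<Rightarrow> real \<Rightarrow> 'a" where
  "vderiv n c = ((\<lambda>g t. vector_derivative g (at t)) ^^ n) c"

definition smooth_curve :: "(real \<Rightarrow> 'a::real_normed_vector) \<Rightarrow> bool" where
  "smooth_curve c \<longleftrightarrow> (\<forall>n t. vderiv n c differentiable (at t))"

definition signed_curvature :: "(real \<Rightarrow> real^2) \<Rightarrow> real \<Rightarrow> real" where
  "signed_curvature c t =
     det (vector [vderiv 1 c t, vderiv 2 c t] :: real^2^2) / norm (vderiv 1 c t) ^ 3"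

text \<open>
  A continuous choice of the angle \<open>\<theta>\<close> for which the unit tangent is
  \<open>(- sin \<theta>, cos \<theta>)\<close>; then \<open>(cos \<theta>, sin \<theta>)\<close> is the normal pointing to the right of the curve.
  It exists for every regular curve and is unique up to an additive multiple of \<open>2 * pi\<close>.
\<close>

definition normal_angle :: "(real \<Rightarrow> real^2) \<Rightarrow> (real \<Rightarrow> real) \<Rightarrow> bool" where
  "normal_angle c \<theta> \<longleftrightarrow> continuous_on UNIV \<theta> \<and>
     (\<forall>t. vderiv 1 c t = norm (vderiv 1 c t) *\<^sub>R vector [- sin (\<theta> t), cos (\<theta> t)])"

definition rotation_number :: "(real \<Rightarrow> real^2) \<Rightarrow> real \<Rightarrow> bool" where
  "rotation_number c r \<longleftrightarrow> (\<exists>\<theta>. normal_angle c \<theta> \<and> \<theta> 1 - \<theta> 0 = 2 * pi * r)"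

definition closed_curves :: "(real \<Rightarrow> real^2) set" where
  "closed_curves = {c. smooth_curve c \<and> (\<forall>t. c (t + 1) = c t)}"

definition rosettes :: "nat \<Rightarrow> (real \<Rightarrow> real^2) set" where
  "rosettes m = {c \<in> closed_curves. (\<forall>t. vderiv 1 c t \<noteq> 0) \<and>
     (\<forall>t. signed_curvature c t > 0) \<and> rotation_number c (real m)}"

text \<open>
  \<open>p \<theta>\<close> is the signed distance from the origin of the tangent line with normal
  \<open>(cos \<theta>, sin \<theta>)\<close>. For an \<open>m\<close>-rosette the normal angle is a bijection of \<open>\<real>\<close>, so it determines
  \<open>p\<close>; different normal angles give the translates of \<open>p\<close> by multiples of \<open>2 * pi\<close>.
\<close>

definition support_function :: "(real \<Rightarrow> real^2) \<Rightarrow> (real \<Rightarrow> real) \<Rightarrow> bool" where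
  "support_function c p \<longleftrightarrow>
     (\<exists>\<theta>. normal_angle c \<theta> \<and> (\<forall>t. p (\<theta> t) = c t \<bullet> vector [cos (\<theta> t), sin (\<theta> t)]))"

section \<open>Genericity\<close>

definition Cinf_nbhd :: "(real \<Rightarrow> real^2) \<Rightarrow> nat \<Rightarrow> real \<Rightarrow> (real \<Rightarrow> real^2) set" where
  "Cinf_nbhd c N e =
     {d \<in> closed_curves. \<forall>j\<le>N. \<forall>t. norm (vderiv j d t - vderiv j c t) < e}"

definition Cinf_open :: "(real \<Rightarrow> real^2) set \<Rightarrow> bool" where
  "Cinf_open U \<longleftrightarrow> U \<subseteq> closed_curves \<and> (\<forall>c\<in>U. \<exists>N. \<exists>e>0. Cinf_nbhd c N e \<subseteq> U)"

definition Cinf_topology :: "(real \<Rightarrow> real^2) topology" where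
  "Cinf_topology = topology Cinf_open"

lemma openin_Cinf_topology: "openin Cinf_topology U \<longleftrightarrow> Cinf_open U"
proof -
  have "istopology Cinf_open"
    unfolding istopology_def
  proof (intro conjI allI impI)
    fix S T assume S: "Cinf_open S" and T: "Cinf_open T"
    show "Cinf_open (S \<inter> T)"
      unfolding Cinf_open_def
    proof (intro conjI ballI)
      show "S \<inter> T \<subseteq> closed_curves" using S by (auto simp: Cinf_open_def)
      fix c assume c: "c \<in> S \<inter> T"
      obtain N e where 1: "e > 0" "Cinf_nbhd c N e \<subseteq> S"
        using S c unfolding Cinf_open_def by blast
      obtain N' e' where 2: "e' > 0" "Cinf_nbhd c N' e' \<subseteq> T"
        using T c unfolding Cinf_open_def by blast
      have "Cinf_nbhd c (max N N') (min e e') \<subseteq> Cinf_nbhd c N e \<inter> Cinf_nbhd c N' e'"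
        by (auto simp: Cinf_nbhd_def)
      then show "\<exists>N. \<exists>e>0. Cinf_nbhd c N e \<subseteq> S \<inter> T"
        using 1 2 by (intro exI[of _ "max N N'"] exI[of _ "min e e'"]) auto
    qed
  next
    fix K assume "\<forall>S\<in>K. Cinf_open S"
    then show "Cinf_open (\<Union>K)"
      unfolding Cinf_open_def by (meson Sup_le_iff Union_iff Union_upper subset_trans)
  qed
  then show ?thesis by (simp add: Cinf_topology_def topology_inverse')
qed

definition rosette_space :: "nat \<Rightarrow> (real \<Rightarrow> real^2) topology" where
  "rosette_space m = subtopology Cinf_topology (rosettes m)"

definition residual_in :: "'a topology \<Rightarrow> 'a set \<Rightarrow> bool" where
  "residual_in X A \<longleftrightarrow> A \<subseteq> topspace X \<and>
     (\<exists>U::nat \<Rightarrow> 'a set. (\<forall>n. openin X (U n) \<and> X closure_of (U n) = topspace X) \<and>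
        (\<Inter>n. U n) \<subseteq> A)"

definition generically :: "'a topology \<Rightarrow> ('a \<Rightarrow> bool) \<Rightarrow> bool" where
  "generically X P \<longleftrightarrow> (\<exists>A. residual_in X A \<and> (\<forall>x\<in>A. P x))"

section \<open>Coherent tangent bundle of a frontal in space\<close>

text \<open>
  In the following, \<open>f\<close> is a map of the \<open>(\<lambda>, \<theta>)\<close>-plane, oriented by \<open>(\<lambda>, \<theta>)\<close>, \<open>\<nu>\<close> is a unit
  normal of \<open>f\<close>, and \<open>\<sigma>\<close> is a curve in this plane.
\<close>

type_synonym frontal = "real \<times> real \<Rightarrow> real^3"

definition psi :: "frontal \<Rightarrow> real \<times> real \<Rightarrow> real \<times> real \<Rightarrow> real^3" where
  "psi f q = frechet_derivative f (at q)"

text \<open>The fiber at \<open>q\<close>, with the metric induced from \<open>\<real>\<^sup>3\<close>, and the orthogonal projection to it.\<close>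

definition fiber :: "frontal \<Rightarrow> real \<times> real \<Rightarrow> (real^3) set" where
  "fiber \<nu> q = {X. X \<bullet> \<nu> q = 0}"

definition fiber_proj :: "frontal \<Rightarrow> real \<times> real \<Rightarrow> real^3 \<Rightarrow> real^3" where
  "fiber_proj \<nu> q X = closest_point (fiber \<nu> q) X"

definition co_orientation :: "frontal \<Rightarrow> real \<times> real \<Rightarrow> real^3 \<Rightarrow> real^3 \<Rightarrow> real" where
  "co_orientation \<nu> q X Y = det (vector [X, Y, \<nu> q] :: real^3^3)"

definition velocity :: "(real \<Rightarrow> real \<times> real) \<Rightarrow> real \<Rightarrow> real \<times> real" where
  "velocity \<sigma> t = vector_derivative \<sigma> (at t)"

text \<open>\<open>D\<^bsub>d/dt\<^esub> X\<close> for a section \<open>X\<close> of the bundle along \<open>\<sigma>\<close>.\<close>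

definition cov_deriv :: "frontal \<Rightarrow> (real \<Rightarrow> real \<times> real) \<Rightarrow> (real \<Rightarrow> real^3) \<Rightarrow> real \<Rightarrow> real^3" where
  "cov_deriv \<nu> \<sigma> X t = fiber_proj \<nu> (\<sigma> t) (vector_derivative X (at t))"

definition geodesic_curvature ::
    "frontal \<Rightarrow> frontal \<Rightarrow> (real \<Rightarrow> real \<times> real) \<Rightarrow> real \<Rightarrow> real" where
  "geodesic_curvature f \<nu> \<sigma> t =
     (let X = (\<lambda>s. psi f (\<sigma> s) (velocity \<sigma> s))
      in co_orientation \<nu> (\<sigma> t) (X t) (cov_deriv \<nu> \<sigma> X t) / norm (X t) ^ 3)"

definition singular_set :: "frontal \<Rightarrow> (real \<times> real) set \<Rightarrow> (real \<times> real) set" where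
  "singular_set f M = {q \<in> M. \<not> inj (psi f q)}"

definition lambda_psi :: "frontal \<Rightarrow> frontal \<Rightarrow> real \<times> real \<Rightarrow> real" where
  "lambda_psi f \<nu> q = co_orientation \<nu> q (psi f q (1, 0)) (psi f q (0, 1))"

definition positively_oriented :: "real \<times> real \<Rightarrow> real \<times> real \<Rightarrow> bool" where
  "positively_oriented v w \<longleftrightarrow> fst v * snd w - snd v * fst w > 0"

text \<open>
  Where the kernel of \<open>psi\<close> is a line transversal to \<open>\<sigma>\<close>, the chosen null vector is unique up to a
  positive factor, which does not affect the sign in the singular curvature. Where the kernel is
  tangent to \<open>\<sigma>\<close>, the value of the singular curvature is meaningless; there \<open>psi\<close> kills the
  velocity, so that the arc length density vanishes.
\<close>

definition null_vector :: "frontal \<Rightarrow> (real \<Rightarrow> real \<times> real) \<Rightarrow> real \<Rightarrow> real \<times> real" where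
  "null_vector f \<sigma> t =
     (SOME \<eta>. psi f (\<sigma> t) \<eta> = 0 \<and> positively_oriented (velocity \<sigma> t) \<eta>)"

definition singular_curvature ::
    "frontal \<Rightarrow> frontal \<Rightarrow> (real \<Rightarrow> real \<times> real) \<Rightarrow> real \<Rightarrow> real" where
  "singular_curvature f \<nu> \<sigma> t =
     sgn (frechet_derivative (lambda_psi f \<nu>) (at (\<sigma> t)) (null_vector f \<sigma> t))
       * geodesic_curvature f \<nu> \<sigma> t"

text \<open>The density of the arc length \<open>d\<tau>\<close> of the first fundamental form of \<open>f\<close> along \<open>\<sigma>\<close>.\<close>

definition arc_density :: "frontal \<Rightarrow> (real \<Rightarrow> real \<times> real) \<Rightarrow> real \<Rightarrow> real" where
  "arc_density f \<sigma> t = norm (psi f (\<sigma> t) (velocity \<sigma> t))"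

section \<open>Branches of the affine extended wave front\<close>

text \<open>
  Maps on \<open>M = [0,1] \<times> \<real>/2m\<pi>\<int>\<close> are given by their lifts in \<open>\<theta>\<close>; the formulas make sense
  for all real \<open>\<lambda>\<close>, and derivatives on the boundary of \<open>M\<close> are those of this extension.
\<close>

definition support_curve :: "(real \<Rightarrow> real) \<Rightarrow> real \<Rightarrow> real^2" where
  "support_curve p \<theta> = vector [p \<theta> * cos \<theta> - deriv p \<theta> * sin \<theta>,
                               p \<theta> * sin \<theta> + deriv p \<theta> * cos \<theta>]"

definition curvature :: "(real \<Rightarrow> real) \<Rightarrow> real \<Rightarrow> real" where
  "curvature p \<theta> = 1 / (p \<theta> + deriv (deriv p) \<theta>)"

definition wave_front :: "nat \<Rightarrow> (real \<Rightarrow> real) \<Rightarrow> frontal" where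
  "wave_front k p = (\<lambda>(l, \<theta>).
     let x = l *\<^sub>R support_curve p \<theta> + (1 - l) *\<^sub>R support_curve p (\<theta> + real k * pi)
     in vector [l, x $ 1, x $ 2])"

definition width :: "nat \<Rightarrow> (real \<Rightarrow> real) \<Rightarrow> real \<Rightarrow> real" where
  "width k p \<theta> = p \<theta> - (-1) ^ k * p (\<theta> + real k * pi)"

definition front_normal :: "nat \<Rightarrow> (real \<Rightarrow> real) \<Rightarrow> frontal" where
  "front_normal k p = (\<lambda>(l, \<theta>).
     (1 / sqrt (1 + (width k p \<theta>)\<^sup>2)) *\<^sub>R vector [width k p \<theta>, - cos \<theta>, - sin \<theta>])"

definition singular_curve :: "nat \<Rightarrow> (real \<Rightarrow> real) \<Rightarrow> real \<Rightarrow> real \<times> real" where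
  "singular_curve k p \<theta> =
     (curvature p \<theta> / (curvature p \<theta> + curvature p (\<theta> + real k * pi)), \<theta>)"

text \<open>
  \<open>\<theta> \<mapsto> (1, \<theta>)\<close> is the boundary orientation: \<open>(\<partial>\<^sub>\<lambda>, \<partial>\<^sub>\<theta>)\<close> is positive and
  \<open>\<partial>\<^sub>\<lambda>\<close> points out of \<open>M\<close> there.
\<close>

definition boundary_curve :: "real \<Rightarrow> real \<times> real" where
  "boundary_curve \<theta> = (1, \<theta>)"

text \<open>The curve above parametrizes the singular set of the front.\<close>

lemma vector3_decomp:
  "(vector [a, b, c] :: real^3) = a *\<^sub>R axis 1 1 + b *\<^sub>R axis 2 1 + c *\<^sub>R axis 3 1"
  by (simp add: vec_eq_iff forall_3 axis_def)

lemma psi_wave_front: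
  assumes p: "\<And>\<theta>. p differentiable at \<theta>" "\<And>\<theta>. deriv p differentiable at \<theta>"
    and "odd k"
  shows "psi (wave_front k p) (l, \<theta>) (a, b) = (let \<rho> = (\<lambda>\<theta>. p \<theta> + deriv (deriv p) \<theta>);
     x = a *\<^sub>R (support_curve p \<theta> - support_curve p (\<theta> + real k * pi))
       + (b * (l * \<rho> \<theta> - (1 - l) * \<rho> (\<theta> + real k * pi))) *\<^sub>R vector [- sin \<theta>, cos \<theta>]
     in vector [a, x $ 1, x $ 2])"
proof -
  have d: "DERIV p t :> deriv p t" "DERIV (deriv p) t :> deriv (deriv p) t" for t
    using p DERIV_deriv_iff_real_differentiable by blast+
  have d1: "(p has_derivative (\<lambda>h. h * deriv p t)) (at t)"
    "(deriv p has_derivative (\<lambda>h. h * deriv (deriv p) t)) (at t)" for t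
    using d[of t] by (simp_all add: has_field_derivative_def mult.commute[of _ "deriv p t"]
      mult.commute[of _ "deriv (deriv p) t"])
  let ?s = "real k * pi"
  have trig: "cos (t + ?s) = - cos t" "sin (t + ?s) = - sin t" for t
    using \<open>odd k\<close> by (simp_all add: cos_add sin_add)
  have dp: "((\<lambda>q. p (snd q)) has_derivative (\<lambda>h. snd h * deriv p \<theta>)) (at (l, \<theta>))"
    "((\<lambda>q. deriv p (snd q)) has_derivative (\<lambda>h. snd h * deriv (deriv p) \<theta>)) (at (l, \<theta>))"
    using has_derivative_compose[OF has_derivative_snd[OF has_derivative_ident], of p _ "(l,\<theta>)" UNIV]
      has_derivative_compose[OF has_derivative_snd[OF has_derivative_ident], of "deriv p" _ "(l,\<theta>)" UNIV] d1
    by auto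
  have s: "((\<lambda>q::real\<times>real. snd q + ?s) has_derivative snd) (at (l, \<theta>))"
    by (auto intro!: derivative_eq_intros)
  have dq: "((\<lambda>q. p (snd q + ?s)) has_derivative (\<lambda>h. snd h * deriv p (\<theta> + ?s))) (at (l, \<theta>))"
    "((\<lambda>q. deriv p (snd q + ?s)) has_derivative (\<lambda>h. snd h * deriv (deriv p) (\<theta> + ?s))) (at (l, \<theta>))"
    using has_derivative_compose[OF s, of p] has_derivative_compose[OF s, of "deriv p"] d1
    by auto
  have f: "wave_front k p = (\<lambda>q. fst q *\<^sub>R axis 1 1
     + (fst q * (p (snd q) * cos (snd q) - deriv p (snd q) * sin (snd q))
        + (1 - fst q) * (deriv p (snd q + ?s) * sin (snd q) - p (snd q + ?s) * cos (snd q))) *\<^sub>R axis 2 1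
     + (fst q * (p (snd q) * sin (snd q) + deriv p (snd q) * cos (snd q))
        + (1 - fst q) * (- p (snd q + ?s) * sin (snd q) - deriv p (snd q + ?s) * cos (snd q))) *\<^sub>R axis 3 1)"
    by (rule ext) (simp add: wave_front_def support_curve_def trig vector3_decomp split_beta Let_def)
  have "(wave_front k p has_derivative (\<lambda>(a, b). (let \<rho> = (\<lambda>\<theta>. p \<theta> + deriv (deriv p) \<theta>);
     x = a *\<^sub>R (support_curve p \<theta> - support_curve p (\<theta> + real k * pi))
       + (b * (l * \<rho> \<theta> - (1 - l) * \<rho> (\<theta> + real k * pi))) *\<^sub>R vector [- sin \<theta>, cos \<theta>]
     in vector [a, x $ 1, x $ 2]))) (at (l, \<theta>))"
    unfolding f
    by (rule derivative_eq_intros dp dq refl | rule ext | clarsimp)+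
       (simp add: support_curve_def trig trig[unfolded mult.commute[of "real k" pi]] vector3_decomp fun_eq_iff vec_eq_iff forall_3 axis_def algebra_simps)
  then show ?thesis
    using fun_cong[OF frechet_derivative_at, of _ _ _ "(a, b)"] unfolding psi_def by fastforce
qed

lemma singular_set_wave_front:
  assumes p: "\<And>\<theta>. p differentiable at \<theta>" "\<And>\<theta>. deriv p differentiable at \<theta>"
    and pos: "\<And>\<theta>. p \<theta> + deriv (deriv p) \<theta> > 0" and "odd k"
  shows "singular_set (wave_front k p) ({0..1} \<times> UNIV) = range (singular_curve k p)"
proof -
  define \<rho> where "\<rho> = (\<lambda>\<theta>. p \<theta> + deriv (deriv p) \<theta>)"
  have pos: "\<rho> t > 0" for t using pos by (simp add: \<rho>_def)
  define A where "A = (\<lambda>l \<theta>. l * \<rho> \<theta> - (1 - l) * \<rho> (\<theta> + real k * pi))"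
  have ps: "psi (wave_front k p) (l, \<theta>) (a, b) = vector
    [a, a * (support_curve p \<theta> - support_curve p (\<theta> + real k * pi)) $ 1 - b * A l \<theta> * sin \<theta>,
     a * (support_curve p \<theta> - support_curve p (\<theta> + real k * pi)) $ 2 + b * A l \<theta> * cos \<theta>]" for l \<theta> a b
    using psi_wave_front[OF p \<open>odd k\<close>, of l \<theta> a b] by (simp add: A_def \<rho>_def Let_def)
  have inj: "inj (psi (wave_front k p) (l, \<theta>)) \<longleftrightarrow> A l \<theta> \<noteq> 0" for l \<theta>
  proof
    assume "inj (psi (wave_front k p) (l, \<theta>))"
    then show "A l \<theta> \<noteq> 0" 
      using ps[of l \<theta> 0 1] ps[of l \<theta> 0 0] by (auto dest!: injD[of _ "(0,1)" "(0,0)"])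
  next
    assume A: "A l \<theta> \<noteq> 0"
    have "a = a' \<and> b = b'" if "psi (wave_front k p) (l, \<theta>) (a, b) = psi (wave_front k p) (l, \<theta>) (a', b')" for a b a' b'
    proof -
      have "a = a'" "b * A l \<theta> * sin \<theta> = b' * A l \<theta> * sin \<theta>" "b * A l \<theta> * cos \<theta> = b' * A l \<theta> * cos \<theta>"
        using that unfolding ps by (auto simp: vec_eq_iff forall_3)
      then show ?thesis using A sin_zero_abs_cos_one[of \<theta>] by auto
    qed
    then show "inj (psi (wave_front k p) (l, \<theta>))" by (auto intro!: injI)
  qed
  have cv: "curvature p t = 1 / \<rho> t" for t by (simp add: curvature_def \<rho>_def)
  have zero: "A l \<theta> = 0 \<longleftrightarrow> l = curvature p \<theta> / (curvature p \<theta> + curvature p (\<theta> + real k * pi))" for l \<theta>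
  proof -
    have c: "curvature p \<theta> / (curvature p \<theta> + curvature p (\<theta> + real k * pi))
        = \<rho> (\<theta> + real k * pi) / (\<rho> \<theta> + \<rho> (\<theta> + real k * pi))"
      using less_imp_neq[OF pos, of \<theta>] less_imp_neq[OF pos, of "\<theta> + real k * pi"]
      by (simp add: cv field_simps)
    have "\<rho> \<theta> + \<rho> (\<theta> + real k * pi) \<noteq> 0"
      using pos[of \<theta>] pos[of "\<theta> + real k * pi"] by linarith
    then show ?thesis unfolding c by (simp add: A_def nonzero_eq_divide_eq algebra_simps)
  qed
  have "0 \<le> curvature p \<theta> / (curvature p \<theta> + curvature p (\<theta> + real k * pi)) \<and>
     curvature p \<theta> / (curvature p \<theta> + curvature p (\<theta> + real k * pi)) \<le> 1" for \<theta>
  proof -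
    have "curvature p t > 0" for t using pos by (simp add: cv)
    from this[of \<theta>] this[of "\<theta> + real k * pi"] show ?thesis by simp
  qed
  then show ?thesis
    by (auto simp: singular_set_def inj zero singular_curve_def)
qed

end

(*
  Put \<rho> = p + p'' and w = w_k; the sum w + w'' is \<rho>(\<theta>) + \<rho>(\<theta> + k \<pi>) > 0. In the frame given by the axis of
  \<lambda>, the normal (cos \<theta>, sin \<theta>) and the tangent (- sin \<theta>, cos \<theta>) the boundary integrand is w / sqrt (1 + w^2), and
  where the derivative of \<lambda>_k does not vanish the singular integrand is
  - (w + w'') sqrt (1 + w^2) / (1 + w^2 + w'^2). They add up to the derivative of the periodic function
  - arctan (w' / sqrt (1 + w^2)), so the integrals cancel as soon as the zeros of \<lambda>_k' form a null set.

  These zeros are the angles where the logarithmic derivative of \<rho> takes the same value at \<theta> and \<theta> + k \<pi>.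
  The measure of this set is upper semicontinuous in the rosette, by Fatou's lemma for limsup of sets. Adding t a to \<rho>
  makes the defining equation a quadratic one in t with leading coefficient a' a_k - a a_k', where a_k(\<theta>) = a(\<theta> + k \<pi>);
  for a suitable trigonometric a this coefficient vanishes on a null set only, so almost every angle is a zero for at most two t.
*)
theory Submission
  imports Defs
begin

text \<open>The unit normal of the front depends on the angle alone, so at each angle the singular
  curve and the boundary curve share one fiber. Geodesic curvature times arc length density is the
  rotation rate of the velocity in that fiber, and the sign in the singular curvature is always -1.
  The sum of the two integrands is therefore the derivative of the angle between the two directions,
  which is periodic; this is where the arctangent comes from. Genericity cannot be dropped: for a
  circle the singular curve is \<lambda> = 1/2, its image is a point and its integrand is 0, while
  the boundary integrand is positive. The same loss occurs whenever the zeros of the derivative of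
  \<lambda>_k have positive measure. Asking only for a null set avoids any transversality argument.
  The zeros are described through derivatives of the curve in its given parameter and not through
  the support function, because the latter of a nearby curve belongs to a different
  reparametrization.\<close>

section \<open>Smooth curves\<close>

text \<open>Each level asks only for some derivative, so closure under products, inverses and
  composition is an induction on the order; with \<open>vderiv\<close> it would need formulas for
  iterated derivatives.\<close>

primrec diff_times :: "nat \<Rightarrow> (real \<Rightarrow> 'a::real_normed_vector) \<Rightarrow> bool" where
  "diff_times 0 f \<longleftrightarrow> True"
| "diff_times (Suc n) f \<longleftrightarrow>
     (\<exists>f'. (\<forall>t. (f has_vector_derivative f' t) (at t)) \<and> diff_times n f')"

lemma vderiv_0 [simp]: "vderiv 0 c = c"
  by (simp add: vderiv_def)

lemma vderiv_Suc: "vderiv (Suc n) c t = vector_derivative (vderiv n c) (at t)"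
  by (simp add: vderiv_def)

lemma vderiv_Suc_shift: "vderiv (Suc n) c = vderiv n (vderiv 1 c)"
  unfolding vderiv_def by (simp only: funpow_Suc_right o_apply One_nat_def funpow.simps id_apply)

lemma diff_times_SucI:
  "(\<And>t. (f has_vector_derivative f' t) (at t)) \<Longrightarrow> diff_times n f' \<Longrightarrow> diff_times (Suc n) f"
  by auto

lemma vderiv_1_eqI:
  "(\<And>t. (f has_vector_derivative f' t) (at t)) \<Longrightarrow> vderiv 1 f = f'"
  by (simp add: fun_eq_iff vderiv_def vector_derivative_at)

lemma diff_times_Suc_iff:
  "diff_times (Suc n) f \<longleftrightarrow> (\<forall>t. f differentiable (at t)) \<and> diff_times n (vderiv 1 f)"
proof
  assume "diff_times (Suc n) f"
  then obtain f' where "\<And>t. (f has_vector_derivative f' t) (at t)" "diff_times n f'"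
    by auto
  then show "(\<forall>t. f differentiable (at t)) \<and> diff_times n (vderiv 1 f)"
    using vderiv_1_eqI[of f f'] by (auto intro: differentiableI_vector)
qed (auto simp: vector_derivative_works vderiv_def)

lemma diff_times_iff: "diff_times n f \<longleftrightarrow> (\<forall>i<n. \<forall>t. vderiv i f differentiable (at t))"
proof (induction n arbitrary: f)
  case (Suc n)
  then show ?case
    unfolding diff_times_Suc_iff Suc.IH less_Suc_eq_0_disj
    by (auto simp: vderiv_Suc_shift simp del: One_nat_def)
qed simp

lemma smooth_curve_iff: "smooth_curve f \<longleftrightarrow> (\<forall>n. diff_times n f)"
  by (auto simp: smooth_curve_def diff_times_iff)

lemma smooth_curveI:
  assumes "\<And>t. (f has_vector_derivative f' t) (at t)" and "smooth_curve f'"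
  shows "smooth_curve f"
proof -
  have "diff_times n f" for n
    using assms by (cases n) (auto simp: smooth_curve_iff)
  then show ?thesis by (simp add: smooth_curve_iff)
qed

lemma smooth_curve_vderiv: "smooth_curve f \<Longrightarrow> smooth_curve (vderiv n f)"
  unfolding smooth_curve_def vderiv_def by (metis comp_apply funpow_add)

lemma smooth_curve_has_vderiv:
  "smooth_curve f \<Longrightarrow> (vderiv n f has_vector_derivative vderiv (Suc n) f t) (at t)"
  by (simp add: smooth_curve_def vderiv_Suc vector_derivative_works)

lemma continuous_on_vderiv: "smooth_curve f \<Longrightarrow> continuous_on A (vderiv n f)"
  by (meson smooth_curve_has_vderiv continuous_at_imp_continuous_on
      has_vector_derivative_continuous)

lemma diff_times_mono: "diff_times (Suc n) f \<Longrightarrow> diff_times n f"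
  by (simp add: diff_times_iff del: diff_times.simps)

lemma diff_times_const: "diff_times n (\<lambda>t. a)"
proof (induction n arbitrary: a)
  case (Suc n)
  show ?case by (auto intro!: exI[of _ "\<lambda>t. 0"] derivative_eq_intros Suc)
qed simp

lemma diff_times_add: "diff_times n f \<Longrightarrow> diff_times n g \<Longrightarrow> diff_times n (\<lambda>t. f t + g t)"
proof (induction n arbitrary: f g)
  case (Suc n)
  then obtain f' g' where "\<And>t. (f has_vector_derivative f' t) (at t)" "diff_times n f'"
    "\<And>t. (g has_vector_derivative g' t) (at t)" "diff_times n g'"
    by auto
  then show ?case
    by (auto intro!: exI[of _ "\<lambda>t. f' t + g' t"] derivative_eq_intros Suc.IH)
qed simp

lemma diff_times_bilinear:
  assumes b: "bounded_bilinear b"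
  shows "diff_times n f \<Longrightarrow> diff_times n g \<Longrightarrow> diff_times n (\<lambda>t. b (f t) (g t))"
proof (induction n arbitrary: f g)
  case (Suc n)
  then obtain f' g' where fg: "\<And>t. (f has_vector_derivative f' t) (at t)" "diff_times n f'"
    "\<And>t. (g has_vector_derivative g' t) (at t)" "diff_times n g'"
    by auto
  have "diff_times n f" "diff_times n g" using Suc.prems diff_times_mono by blast+
  then show ?case using fg
    by (auto intro!: exI[of _ "\<lambda>t. b (f t) (g' t) + b (f' t) (g t)"] diff_times_add Suc.IH
        bounded_bilinear.has_vector_derivative[OF b])
qed simp

lemma diff_times_linear:
  assumes b: "bounded_linear b"
  shows "diff_times n f \<Longrightarrow> diff_times n (\<lambda>t. b (f t))"
proof (induction n arbitrary: f)
  case (Suc n)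
  then obtain f' where fg: "\<And>t. (f has_vector_derivative f' t) (at t)" "diff_times n f'"
    by auto
  then show ?case
    by (auto intro!: exI[of _ "\<lambda>t. b (f' t)"] Suc.IH bounded_linear.has_vector_derivative[OF b])
qed simp

lemma diff_times_inverse:
  fixes f :: "real \<Rightarrow> real"
  assumes nz: "\<And>t. f t \<noteq> 0"
  shows "diff_times n f \<Longrightarrow> diff_times n (\<lambda>t. inverse (f t))"
proof (induction n)
  case (Suc n)
  then obtain f' where f: "\<And>t. (f has_vector_derivative f' t) (at t)" "diff_times n f'"
    by auto
  have i: "diff_times n (\<lambda>t. inverse (f t))" using Suc diff_times_mono by blast
  have "((\<lambda>t. inverse (f t)) has_vector_derivative (- 1) * (f' t * (inverse (f t) * inverse (f t)))) (at t)" for t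
    using f(1)[of t] nz[of t]
    by (auto simp flip: has_real_derivative_iff_has_vector_derivative intro!: derivative_eq_intros)
  moreover have "diff_times n (\<lambda>t. (- 1) * (f' t * (inverse (f t) * inverse (f t))))"
    by (intro diff_times_bilinear[OF bounded_bilinear_mult] diff_times_const i f)
  ultimately show ?case by (rule diff_times_SucI)
qed simp

lemma diff_times_sin_cos:
  fixes f :: "real \<Rightarrow> real"
  shows "diff_times n f \<Longrightarrow> diff_times n (\<lambda>t. sin (f t)) \<and> diff_times n (\<lambda>t. cos (f t))"
proof (induction n)
  case (Suc n)
  then obtain f' where f: "\<And>t. (f has_vector_derivative f' t) (at t)" "diff_times n f'"
    by auto
  have i: "diff_times n (\<lambda>t. sin (f t))" "diff_times n (\<lambda>t. cos (f t))"
    using Suc diff_times_mono by blast+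
  have "((\<lambda>t. sin (f t)) has_vector_derivative f' t * cos (f t)) (at t)"
    "((\<lambda>t. cos (f t)) has_vector_derivative (- 1) * (f' t * sin (f t))) (at t)" for t
    using f(1)[of t]
    by (auto simp flip: has_real_derivative_iff_has_vector_derivative intro!: derivative_eq_intros)
  moreover have "diff_times n (\<lambda>t. f' t * cos (f t))" "diff_times n (\<lambda>t. (- 1) * (f' t * sin (f t)))"
    by (intro diff_times_bilinear[OF bounded_bilinear_mult] diff_times_const i f)+
  ultimately show ?case by (intro conjI diff_times_SucI)
qed simp

lemma smooth_curve_const: "smooth_curve (\<lambda>t. a)"
  by (simp add: smooth_curve_iff diff_times_const)

lemma smooth_curve_add: "smooth_curve f \<Longrightarrow> smooth_curve g \<Longrightarrow> smooth_curve (\<lambda>t. f t + g t)"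
  by (simp add: smooth_curve_iff diff_times_add)

lemma smooth_curve_bilinear:
  "bounded_bilinear b \<Longrightarrow> smooth_curve f \<Longrightarrow> smooth_curve g \<Longrightarrow> smooth_curve (\<lambda>t. b (f t) (g t))"
  by (simp add: smooth_curve_iff diff_times_bilinear)

lemmas smooth_curve_mult = smooth_curve_bilinear[OF bounded_bilinear_mult]
lemmas smooth_curve_scaleR = smooth_curve_bilinear[OF bounded_bilinear_scaleR]
lemmas smooth_curve_inner = smooth_curve_bilinear[OF bounded_bilinear_inner]

lemma smooth_curve_linear: "bounded_linear b \<Longrightarrow> smooth_curve f \<Longrightarrow> smooth_curve (\<lambda>t. b (f t))"
  by (simp add: smooth_curve_iff diff_times_linear)

lemma smooth_curve_divide:
  fixes f g :: "real \<Rightarrow> real"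
  shows "smooth_curve f \<Longrightarrow> smooth_curve g \<Longrightarrow> (\<And>t. g t \<noteq> 0) \<Longrightarrow> smooth_curve (\<lambda>t. f t / g t)"
  unfolding divide_inverse
  by (intro smooth_curve_mult) (auto simp: smooth_curve_iff intro: diff_times_inverse)

lemma smooth_curve_sin: "smooth_curve f \<Longrightarrow> smooth_curve (\<lambda>t. sin (f t :: real))"
  and smooth_curve_cos: "smooth_curve f \<Longrightarrow> smooth_curve (\<lambda>t. cos (f t :: real))"
  by (simp_all add: smooth_curve_iff diff_times_sin_cos)

lemma vector_2_axis: "(vector [a, b] :: real^2) = a *\<^sub>R axis 1 1 + b *\<^sub>R axis 2 1"
  by (simp add: vec_eq_iff forall_2 axis_def)

lemma smooth_curve_vector2:
  assumes "smooth_curve f" "smooth_curve g"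
  shows "smooth_curve (\<lambda>t. vector [f t, g t] :: real^2)"
  unfolding vector_2_axis
  by (rule smooth_curve_add; rule smooth_curve_scaleR[OF assms(1) smooth_curve_const]
      smooth_curve_scaleR[OF assms(2) smooth_curve_const])

text \<open>In the application G inverts the normal angle and g is the derivative of that angle. The
  derivative of f o G is (f' / g) o G, again a smooth function composed with G, so an induction over
  all smooth f closes.\<close>

lemma smooth_curve_compose_inverse:
  fixes f :: "real \<Rightarrow> real"
  assumes G: "\<And>x. (G has_vector_derivative 1 / g (G x)) (at x)"
    and g: "smooth_curve g" "\<And>t. g t \<noteq> 0" and f: "smooth_curve f"
  shows "smooth_curve (\<lambda>x. f (G x))"
proof -
  have "smooth_curve f \<Longrightarrow> diff_times n (\<lambda>x. f (G x))" for n and f :: "real \<Rightarrow> real"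
  proof (induction n arbitrary: f)
    case (Suc n)
    have "(f has_vector_derivative vderiv 1 f (G x)) (at (G x))" for x
      using smooth_curve_has_vderiv[OF Suc.prems, of 0 "G x"] by simp
    then have "((f o G) has_vector_derivative (1 / g (G x)) *\<^sub>R vderiv 1 f (G x)) (at x)" for x
      by (rule vector_diff_chain_at[OF G])
    then have "((\<lambda>x. f (G x)) has_vector_derivative vderiv 1 f (G x) / g (G x)) (at x)" for x
      by (simp add: o_def)
    moreover have "smooth_curve (\<lambda>t. vderiv 1 f t / g t)"
      by (rule smooth_curve_divide[OF smooth_curve_vderiv[OF Suc.prems] g])
    then have "diff_times n (\<lambda>x. vderiv 1 f (G x) / g (G x))"
      by (rule Suc.IH)
    ultimately show ?case by (rule diff_times_SucI)
  qed simp
  then show ?thesis using f by (simp add: smooth_curve_iff)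
qed

section \<open>Rosettes and their normal angle\<close>

definition unit_normal :: "real \<Rightarrow> real^2" where
  "unit_normal x = vector [cos x, sin x]"

definition unit_tangent :: "real \<Rightarrow> real^2" where
  "unit_tangent x = vector [- sin x, cos x]"

definition cross2 :: "real^2 \<Rightarrow> real^2 \<Rightarrow> real" where
  "cross2 a b = a $ 1 * b $ 2 - a $ 2 * b $ 1"

text \<open>The signed curvature times the speed, which is the derivative of every normal angle. The
  formula makes sense before an angle is chosen.\<close>

definition turning :: "(real \<Rightarrow> real^2) \<Rightarrow> real \<Rightarrow> real" where
  "turning c t = cross2 (vderiv 1 c t) (vderiv 2 c t) / (vderiv 1 c t \<bullet> vderiv 1 c t)"

lemma inner_vec2: "(a::real^2) \<bullet> b = a $ 1 * b $ 1 + a $ 2 * b $ 2"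
  by (simp add: inner_vec_def sum_2)

lemma bounded_bilinear_cross2: "bounded_bilinear cross2"
  unfolding bilinear_conv_bounded_bilinear[symmetric] bilinear_def
  by (auto intro!: linearI simp: cross2_def algebra_simps)

lemma signed_curvature_eq:
  "signed_curvature c t = cross2 (vderiv 1 c t) (vderiv 2 c t) / norm (vderiv 1 c t) ^ 3"
  by (simp add: signed_curvature_def cross2_def det_2)

lemma unit_normal_deriv: "(unit_normal has_vector_derivative unit_tangent x) (at x)"
  and unit_tangent_deriv: "(unit_tangent has_vector_derivative - unit_normal x) (at x)"
  unfolding unit_normal_def unit_tangent_def vector_2_axis
  by (auto intro!: derivative_eq_intros simp flip: has_real_derivative_iff_has_vector_derivative)

lemma inner_unit [simp]:
  "unit_normal x \<bullet> unit_tangent x = 0" "unit_tangent x \<bullet> unit_normal x = 0"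
  "unit_normal x \<bullet> unit_normal x = 1" "unit_tangent x \<bullet> unit_tangent x = 1"
  by (simp_all add: unit_normal_def unit_tangent_def inner_vec2 flip: power2_eq_square)

lemma norm_unit_tangent [simp]: "norm (unit_tangent x) = 1"
  by (simp add: norm_eq_sqrt_inner)

lemma has_real_derivative_inner:
  "(f has_vector_derivative f') (at t) \<Longrightarrow> (g has_vector_derivative g') (at t) \<Longrightarrow>
    ((\<lambda>t. f t \<bullet> g t) has_real_derivative f t \<bullet> g' + f' \<bullet> g t) (at t)"
  unfolding has_real_derivative_iff_has_vector_derivative
  by (rule bounded_bilinear.has_vector_derivative[OF bounded_bilinear_inner])

text \<open>A normal angle is only continuous by definition. Near t it equals \<theta> t plus the
  arctangent of a quotient of components of the velocity in the fixed frame at \<theta> t, and that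
  expression is differentiable.\<close>

lemma normal_angle_has_real_derivative:
  assumes c: "smooth_curve c" and reg: "\<And>t. vderiv 1 c t \<noteq> 0" and \<theta>: "normal_angle c \<theta>"
  shows "(\<theta> has_real_derivative turning c t) (at t)"
proof -
  have c': "vderiv 1 c s = norm (vderiv 1 c s) *\<^sub>R unit_tangent (\<theta> s)" for s
    using \<theta> by (simp add: normal_angle_def unit_tangent_def)
  define a where "a = (\<lambda>s. - (vderiv 1 c s \<bullet> unit_normal (\<theta> t)))"
  define b where "b = (\<lambda>s. vderiv 1 c s \<bullet> unit_tangent (\<theta> t))"
  have a: "a s = norm (vderiv 1 c s) * sin (\<theta> s - \<theta> t)" for s
    unfolding a_def by (subst c') (simp add: unit_normal_def unit_tangent_def inner_vec2 sin_diff algebra_simps)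
  have b: "b s = norm (vderiv 1 c s) * cos (\<theta> s - \<theta> t)" for s
    unfolding b_def by (subst c') (simp add: unit_normal_def unit_tangent_def inner_vec2 cos_diff algebra_simps)
  have d: "(vderiv 1 c has_vector_derivative vderiv 2 c t) (at t)"
    using smooth_curve_has_vderiv[OF c, of 1 t] by (simp add: numeral_2_eq_2)
  have da: "(a has_real_derivative - (vderiv 2 c t \<bullet> unit_normal (\<theta> t))) (at t)"
    unfolding a_def using has_real_derivative_inner[OF d has_vector_derivative_const]
    by (auto intro!: derivative_eq_intros)
  have db: "(b has_real_derivative vderiv 2 c t \<bullet> unit_tangent (\<theta> t)) (at t)"
    unfolding b_def using has_real_derivative_inner[OF d has_vector_derivative_const] by simp
  have n: "norm (vderiv 1 c t) \<noteq> 0" using reg by simp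
  have "turning c t = - (vderiv 2 c t \<bullet> unit_normal (\<theta> t)) / norm (vderiv 1 c t)"
    unfolding turning_def dot_square_norm
    by (subst c') (use n in \<open>simp add: cross2_def unit_normal_def unit_tangent_def inner_vec2 power2_eq_square field_simps\<close>)
  then have "((\<lambda>s. \<theta> t + arctan (a s / b s)) has_real_derivative turning c t) (at t)"
    using n a[of t] b[of t] by (auto intro!: derivative_eq_intros da db simp: power2_eq_square)
  \<comment> \<open>The arctangent recovers the difference of angles only below a quarter turn; here
    the continuity of \<theta> enters.\<close>
  moreover have "eventually (\<lambda>s. \<theta> s = \<theta> t + arctan (a s / b s)) (nhds t)"
  proof -
    have "isCont \<theta> t" using \<theta> by (simp add: normal_angle_def continuous_on_eq_continuous_at)
    then have "eventually (\<lambda>s. dist (\<theta> s) (\<theta> t) < pi / 2) (at t)"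
      using tendstoD[of \<theta> "\<theta> t" "at t" "pi/2"] by (simp add: isCont_def)
    then have "eventually (\<lambda>s. dist (\<theta> s) (\<theta> t) < pi / 2) (nhds t)"
      by (simp add: eventually_nhds_conv_at)
    then show ?thesis
    proof eventually_elim
      case (elim s)
      then have "- (pi / 2) < \<theta> s - \<theta> t" "\<theta> s - \<theta> t < pi / 2" unfolding dist_real_def by linarith+
      then have "arctan (tan (\<theta> s - \<theta> t)) = \<theta> s - \<theta> t" by (rule arctan_tan)
      then show ?case using reg[of s] by (simp add: a b tan_def)
    qed
  qed
  ultimately show ?thesis
    by (subst DERIV_cong_ev[OF refl _ refl]) auto
qed

lemma smooth_curve_turning:
  assumes "smooth_curve c" "\<And>t. vderiv 1 c t \<noteq> 0"
  shows "smooth_curve (turning c)"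
  unfolding turning_def using assms
  by (intro smooth_curve_divide smooth_curve_bilinear[OF bounded_bilinear_cross2]
      smooth_curve_inner smooth_curve_vderiv) auto

lemma vderiv_periodic:
  assumes f: "smooth_curve f" and per: "\<And>t. f (t + T) = f t"
  shows "vderiv n f (t + T) = vderiv n f t"
proof (induction n arbitrary: t)
  case (Suc n)
  have "(vderiv n f \<circ> (\<lambda>t. t + T) has_vector_derivative 1 *\<^sub>R vderiv (Suc n) f (t + T)) (at t)"
    by (intro vector_diff_chain_at smooth_curve_has_vderiv f) (auto intro!: derivative_eq_intros)
  then have "(vderiv n f has_vector_derivative vderiv (Suc n) f (t + T)) (at t)"
    by (simp add: o_def Suc.IH)
  then show ?case
    using smooth_curve_has_vderiv[OF f] vector_derivative_unique_at by blast
qed (simp add: per)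

lemma DERIV_zero_diff_const:
  fixes f g :: "real \<Rightarrow> real"
  assumes "\<And>t. (f has_real_derivative f' t) (at t)" "\<And>t. (g has_real_derivative f' t) (at t)"
  shows "f s - g s = f t - g t"
proof -
  have "((\<lambda>t. f t - g t) has_real_derivative 0) (at t)" for t
    using DERIV_diff[OF assms(1)[of t] assms(2)[of t]] by simp
  then show ?thesis using DERIV_isconst_all[of "\<lambda>t. f t - g t" s t] by blast
qed

text \<open>The derivative of log \<rho> by the normal angle, where \<rho> = |c'|^3 / cross2 c' c''
  is the radius of curvature: the parameter derivative of log \<rho> divided by
  \<open>turning\<close>. Derivatives of c occur up to order 3 only.\<close>

definition log_rate :: "(real \<Rightarrow> real^2) \<Rightarrow> real \<Rightarrow> real" where
  "log_rate c t = 3 * (vderiv 1 c t \<bullet> vderiv 2 c t) / cross2 (vderiv 1 c t) (vderiv 2 c t)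
     - (vderiv 1 c t \<bullet> vderiv 1 c t) * cross2 (vderiv 1 c t) (vderiv 3 c t)
        / (cross2 (vderiv 1 c t) (vderiv 2 c t))\<^sup>2"

text \<open>With g the turning, |c'|^2 = (\<rho> g)^2 and cross2 c' c'' = \<rho>^2 g^3; when both
  are differentiated, the terms with g' cancel. Since \<rho> is arbitrary, perturbed curves with a
  radius in closed form are covered as well.\<close>

lemma log_rate_eq:
  assumes c: "smooth_curve c" and reg: "\<And>t. vderiv 1 c t \<noteq> 0" and \<theta>: "normal_angle c \<theta>"
    and speed: "\<And>t. norm (vderiv 1 c t) = \<rho> (\<theta> t) * turning c t"
    and \<rho>: "\<And>x. (\<rho> has_real_derivative \<rho>' x) (at x)"
  shows "log_rate c t = \<rho>' (\<theta> t) / \<rho> (\<theta> t)"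
proof -
  have nz: "\<rho> (\<theta> s) \<noteq> 0" "turning c s \<noteq> 0" for s using speed[of s] reg[of s] by auto
  define g where "g = turning c"
  define g' where "g' = vderiv 1 g"
  have g: "(g has_real_derivative g' s) (at s)" for s
    using smooth_curve_has_vderiv[OF smooth_curve_turning[OF c reg], of 0 s]
    by (simp add: g_def g'_def has_real_derivative_iff_has_vector_derivative)
  have \<theta>': "(\<theta> has_real_derivative g s) (at s)" for s
    unfolding g_def by (rule normal_angle_has_real_derivative[OF c reg \<theta>])
  have \<rho>\<theta>: "((\<lambda>s. \<rho> (\<theta> s)) has_real_derivative \<rho>' (\<theta> s) * g s) (at s)" for s
    by (rule DERIV_chain2[OF \<rho> \<theta>'])
  have N: "vderiv 1 c s \<bullet> vderiv 1 c s = (\<rho> (\<theta> s) * g s)\<^sup>2" for s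
    by (simp only: dot_square_norm speed g_def)
  have D: "cross2 (vderiv 1 c s) (vderiv 2 c s) = (\<rho> (\<theta> s))\<^sup>2 * g s ^ 3" for s
  proof -
    have "cross2 (vderiv 1 c s) (vderiv 2 c s) = (vderiv 1 c s \<bullet> vderiv 1 c s) * g s"
      using reg[of s] by (simp add: g_def turning_def)
    then show ?thesis unfolding N by (simp add: power_mult_distrib power2_eq_square power3_eq_cube)
  qed
  have c1: "(vderiv 1 c has_vector_derivative vderiv 2 c s) (at s)"
    and c2: "(vderiv 2 c has_vector_derivative vderiv 3 c s) (at s)" for s
    using smooth_curve_has_vderiv[OF c, of 1 s] smooth_curve_has_vderiv[OF c, of 2 s]
    by (simp_all add: numeral_2_eq_2 numeral_3_eq_3)
  have "((\<lambda>s. vderiv 1 c s \<bullet> vderiv 1 c s) has_real_derivative 2 * (vderiv 1 c t \<bullet> vderiv 2 c t)) (at t)"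
    using has_real_derivative_inner[OF c1 c1] by (simp add: inner_commute)
  moreover have "((\<lambda>s. (\<rho> (\<theta> s) * g s)\<^sup>2) has_real_derivative
      2 * (\<rho> (\<theta> t) * g t) * (\<rho>' (\<theta> t) * g t * g t + \<rho> (\<theta> t) * g' t)) (at t)"
    by (auto intro!: derivative_eq_intros \<rho>\<theta> g simp: algebra_simps power2_eq_square)
  ultimately have e1: "vderiv 1 c t \<bullet> vderiv 2 c t
      = (\<rho> (\<theta> t) * g t) * (\<rho>' (\<theta> t) * g t * g t + \<rho> (\<theta> t) * g' t)"
    unfolding N using DERIV_unique by fastforce
  have "((\<lambda>s. cross2 (vderiv 1 c s) (vderiv 2 c s)) has_real_derivative
      cross2 (vderiv 1 c t) (vderiv 3 c t)) (at t)"
    using bounded_bilinear.has_vector_derivative[OF bounded_bilinear_cross2 c1[of t] c2[of t]]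
    by (simp add: has_real_derivative_iff_has_vector_derivative cross2_def)
  moreover have "((\<lambda>s. (\<rho> (\<theta> s))\<^sup>2 * g s ^ 3) has_real_derivative
      2 * \<rho> (\<theta> t) * \<rho>' (\<theta> t) * g t ^ 4 + 3 * (\<rho> (\<theta> t))\<^sup>2 * (g t)\<^sup>2 * g' t) (at t)"
    by (auto intro!: derivative_eq_intros \<rho>\<theta> g simp: power2_eq_square power3_eq_cube power4_eq_xxxx)
  ultimately have e2: "cross2 (vderiv 1 c t) (vderiv 3 c t)
      = 2 * \<rho> (\<theta> t) * \<rho>' (\<theta> t) * g t ^ 4 + 3 * (\<rho> (\<theta> t))\<^sup>2 * (g t)\<^sup>2 * g' t"
    unfolding D using DERIV_unique by blast
  show ?thesis
    using nz[of t] unfolding log_rate_def e1 e2 N D g_def[symmetric]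
    by (simp add: field_simps power2_eq_square power3_eq_cube power4_eq_xxxx)
qed

section \<open>The normal angle as the parameter of a rosette\<close>

locale rosette_angle =
  fixes m :: nat and c :: "real \<Rightarrow> real^2" and \<theta> :: "real \<Rightarrow> real"
  assumes m: "m \<ge> 1" and rosette: "c \<in> rosettes m" and angle: "normal_angle c \<theta>"
begin

lemma smooth: "smooth_curve c" and period: "c (t + 1) = c t" and regular: "vderiv 1 c t \<noteq> 0"
  using rosette by (auto simp: rosettes_def closed_curves_def)

lemma cross2_pos: "cross2 (vderiv 1 c t) (vderiv 2 c t) > 0"
  using rosette by (auto simp: rosettes_def signed_curvature_eq zero_less_divide_iff)

lemma turning_pos: "turning c t > 0"
  using cross2_pos[of t] regular[of t] by (simp add: turning_def)

lemma angle_deriv: "(\<theta> has_real_derivative turning c t) (at t)"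
  by (rule normal_angle_has_real_derivative[OF smooth regular angle])

text \<open>The rotation number provides one normal angle with this increment over [0, 1]; any other
  has the same derivative and hence the same increments.\<close>

lemma angle_period: "\<theta> (t + 1) = \<theta> t + 2 * pi * real m"
proof -
  obtain \<phi> where \<phi>: "normal_angle c \<phi>" "\<phi> 1 - \<phi> 0 = 2 * pi * real m"
    using rosette by (auto simp: rosettes_def rotation_number_def)
  have "\<theta> 1 - \<phi> 1 = \<theta> 0 - \<phi> 0"
    by (rule DERIV_zero_diff_const[OF angle_deriv
          normal_angle_has_real_derivative[OF smooth regular \<phi>(1)]])
  then have 1: "\<theta> 1 - \<theta> 0 = 2 * pi * real m" using \<phi>(2) by simp
  have "((\<lambda>t. \<theta> (t + 1)) has_real_derivative turning c t) (at t)" for t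
    using angle_deriv[of "t + 1"] vderiv_periodic[of c 1, OF smooth period]
    by (simp add: DERIV_shift turning_def)
  from DERIV_zero_diff_const[OF this angle_deriv, of t 0] 1 show ?thesis by simp
qed

lemma angle_period_nat: "\<theta> (t + real n) = \<theta> t + 2 * pi * real m * real n"
proof (induction n)
  case (Suc n)
  then show ?case using angle_period[of "t + real n"] by (simp add: algebra_simps)
qed simp

lemma strict_mono_angle: "strict_mono \<theta>"
proof (rule strict_monoI)
  fix s t :: real assume "s < t"
  then show "\<theta> s < \<theta> t"
    by (rule DERIV_pos_imp_increasing) (use angle_deriv turning_pos in blast)
qed

lemma isCont_angle: "isCont \<theta> t"
  using angle_deriv DERIV_isCont by blast

lemma bij_angle: "bij \<theta>"
proof (rule bijI)
  show "inj \<theta>" by (rule strict_mono_imp_inj_on[OF strict_mono_angle])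
  show "surj \<theta>"
  proof (rule surjI)
    fix x
    obtain n where "\<bar>x - \<theta> 0\<bar> < real n" using reals_Archimedean2 by blast
    \<comment> \<open>A crude bound for the growth of the angle over n periods, enough to bracket
      x.\<close>
    moreover have "real n \<le> 2 * pi * real m * real n"
      using m pi_gt3 mult_mono[of 1 "2 * pi" 1 "real m"] by (simp add: mult_le_cancel_right1)
    ultimately have "\<theta> (- real n) \<le> x" "x \<le> \<theta> (real n)"
      using angle_period_nat[of "- real n" n] angle_period_nat[of 0 n] by auto
    then have "\<exists>t. \<theta> t = x"
      using IVT[of \<theta> "- real n" x "real n"] isCont_angle by auto
    then show "\<theta> (SOME t. \<theta> t = x) = x" by (rule someI_ex)
  qed
qed

definition param :: "real \<Rightarrow> real" where "param = inv \<theta>"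

lemma param_angle [simp]: "param (\<theta> t) = t" and angle_param [simp]: "\<theta> (param x) = x"
  using bij_angle by (simp_all add: param_def bij_is_inj bij_is_surj surj_f_inv_f)

lemma param_deriv: "(param has_real_derivative 1 / turning c (param x)) (at x)"
proof -
  have "isCont param (\<theta> (param x))"
    by (rule isCont_inverse_function[of 1]) (auto simp: isCont_angle)
  then have "(param has_real_derivative inverse (turning c (param x))) (at x)"
    using angle_deriv[of "param x"] turning_pos[of "param x"]
    by (intro DERIV_inverse_function[where f = \<theta> and a = "x - 1" and b = "x + 1"]) auto
  then show ?thesis by (simp add: inverse_eq_divide)
qed

lemma param_period: "param (x + 2 * pi * real m) = param x + 1"
  using param_angle[of "param x + 1"] by (simp add: angle_period)

lemma smooth_turning: "smooth_curve (turning c)"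
  by (rule smooth_curve_turning[OF smooth regular])

lemma smooth_angle: "smooth_curve \<theta>"
  using angle_deriv unfolding has_real_derivative_iff_has_vector_derivative
  by (rule smooth_curveI[OF _ smooth_turning])

lemma smooth_compose_param: "smooth_curve f \<Longrightarrow> smooth_curve (\<lambda>x. f (param x) :: real)"
  by (rule smooth_curve_compose_inverse[OF _ smooth_turning])
     (use param_deriv turning_pos in \<open>auto simp: has_real_derivative_iff_has_vector_derivative less_le\<close>)

lemma smooth_unit: "smooth_curve (\<lambda>t. unit_normal (\<theta> t))" "smooth_curve (\<lambda>t. unit_tangent (\<theta> t))"
  unfolding unit_normal_def unit_tangent_def
  by (rule smooth_curve_vector2 smooth_curve_sin smooth_curve_cos smooth_angle
      smooth_curve_linear[OF bounded_linear_minus[OF bounded_linear_ident]])+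

lemma velocity_eq: "vderiv 1 c t = norm (vderiv 1 c t) *\<^sub>R unit_tangent (\<theta> t)"
  using angle by (simp add: normal_angle_def unit_tangent_def)

text \<open>Trades the norm, whose smoothness is not immediate, for an inner product of smooth
  curves.\<close>

lemma speed_eq: "norm (vderiv 1 c t) = vderiv 1 c t \<bullet> unit_tangent (\<theta> t)"
  by (subst (2) velocity_eq) simp

definition radius :: "real \<Rightarrow> real" where
  "radius x = norm (vderiv 1 c (param x)) / turning c (param x)"

lemma radius_pos: "radius x > 0"
  using regular turning_pos by (simp add: radius_def)

lemma speed_radius: "norm (vderiv 1 c t) = radius (\<theta> t) * turning c t"
  using turning_pos[of t] by (simp add: radius_def)

lemma smooth_radius: "smooth_curve radius"
proof -
  have "smooth_curve (\<lambda>t. norm (vderiv 1 c t) / turning c t)"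
    unfolding speed_eq using turning_pos
    by (intro smooth_curve_divide smooth_curve_inner smooth_curve_vderiv smooth smooth_unit smooth_turning)
       (metis less_irrefl)
  from smooth_compose_param[OF this] show ?thesis by (simp add: radius_def[abs_def])
qed

lemma compose_param_deriv:
  fixes f :: "real \<Rightarrow> 'a::real_normed_vector"
  assumes "\<And>t. (f has_vector_derivative f' t) (at t)"
  shows "((\<lambda>x. f (param x)) has_vector_derivative (1 / turning c (param x)) *\<^sub>R f' (param x)) (at x)"
  using vector_diff_chain_at[of param _ x f] param_deriv[of x] assms
  by (simp add: o_def has_real_derivative_iff_has_vector_derivative)

context
  fixes p :: "real \<Rightarrow> real"
  assumes support: "\<And>t. p (\<theta> t) = c t \<bullet> unit_normal (\<theta> t)"
begin

lemma support_eq: "p x = c (param x) \<bullet> unit_normal x"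
  using support[of "param x"] by simp

lemma c_param_deriv: "((\<lambda>x. c (param x)) has_vector_derivative radius x *\<^sub>R unit_tangent x) (at x)"
proof -
  have "(1 / turning c t) *\<^sub>R vderiv 1 c t = radius (\<theta> t) *\<^sub>R unit_tangent (\<theta> t)" for t
    using turning_pos[of t] by (subst velocity_eq) (simp add: speed_radius del: One_nat_def)
  from this[of "param x"] show ?thesis
    using compose_param_deriv[of c "vderiv 1 c" x] smooth_curve_has_vderiv[OF smooth, of 0] by simp
qed

lemma support_deriv: "(p has_real_derivative c (param x) \<bullet> unit_tangent x) (at x)"
  unfolding support_eq[abs_def]
  using has_real_derivative_inner[OF c_param_deriv unit_normal_deriv] by simp

text \<open>Together with \<open>support_deriv\<close> this identifies \<open>radius\<close> with p
  + p'', the form in which the front uses it.\<close>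

lemma support_deriv2:
  "((\<lambda>x. c (param x) \<bullet> unit_tangent x) has_real_derivative radius x - p x) (at x)"
  unfolding support_eq[abs_def]
  using has_real_derivative_inner[OF c_param_deriv unit_tangent_deriv] by simp

lemma support_period: "p (x + 2 * pi * real m) = p x"
proof -
  have "unit_normal (x + 2 * pi * real m) = unit_normal x"
    using sin.plus_of_nat[of x m] cos.plus_of_nat[of x m]
    by (simp add: unit_normal_def mult_ac)
  then show ?thesis by (simp add: support_eq param_period period)
qed

end

end

section \<open>Curvature integrands of the front\<close>

text \<open>Coordinates in an orthonormal frame that rotates with x. Norms, inner products and
  determinants do not see x; only \<open>frame_deriv\<close> does, where the rotation adds - d and
  b.\<close>

definition frame :: "real \<Rightarrow> real \<Rightarrow> real \<Rightarrow> real \<Rightarrow> real^3" where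
  "frame x a b d = vector [a, b * cos x - d * sin x, b * sin x + d * cos x]"

lemma frame_eq_0_iff: "frame x a b d = 0 \<longleftrightarrow> a = 0 \<and> b = 0 \<and> d = 0"
proof
  assume "frame x a b d = 0"
  then have e: "a = 0" "b * cos x - d * sin x = 0" "b * sin x + d * cos x = 0"
    by (simp_all add: frame_def vec_eq_iff forall_3)
  have "b = (b * cos x - d * sin x) * cos x + (b * sin x + d * cos x) * sin x"
    "d = (b * sin x + d * cos x) * cos x - (b * cos x - d * sin x) * sin x"
    using sin_cos_squared_add3[of x] by algebra+
  then show "a = 0 \<and> b = 0 \<and> d = 0" unfolding e(2,3) using e(1) by simp
qed (simp add: frame_def vec_eq_iff forall_3)

lemma inner_frame: "frame x a b d \<bullet> frame x a' b' d' = a * a' + b * b' + d * d'"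
proof -
  have "(b * cos x - d * sin x) * (b' * cos x - d' * sin x)
      + (b * sin x + d * cos x) * (b' * sin x + d' * cos x) = b * b' + d * d'"
    using sin_cos_squared_add3[of x] by algebra
  then show ?thesis by (simp add: frame_def inner_vec_def sum_3)
qed

lemma norm_frame: "norm (frame x a b d) = sqrt (a\<^sup>2 + b\<^sup>2 + d\<^sup>2)"
  by (simp add: norm_eq_sqrt_inner inner_frame power2_eq_square)

lemma det_frame:
  "det (vector [frame x a b d, frame x a' b' d', frame x a'' b'' d''] :: real^3^3)
     = a * (b' * d'' - d' * b'') - b * (a' * d'' - d' * a'') + d * (a' * b'' - b' * a'')"
  by (simp add: frame_def det_3) (use sin_cos_squared_add3[of x] in algebra)

lemma frame_deriv:
  assumes "(a has_real_derivative a') (at x)" "(b has_real_derivative b') (at x)"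
    "(d has_real_derivative d') (at x)"
  shows "((\<lambda>x. frame x (a x) (b x) (d x)) has_vector_derivative
    frame x a' (b' - d x) (d' + b x)) (at x)"
  unfolding frame_def vector3_decomp
  by (rule derivative_eq_intros refl assms[unfolded has_real_derivative_iff_has_vector_derivative]
      | simp flip: has_real_derivative_iff_has_vector_derivative)+
     (auto intro!: derivative_eq_intros assms simp: algebra_simps)

lemma fiber_proj_eq:
  assumes "norm (\<nu> q) = 1"
  shows "fiber_proj \<nu> q X = X - (X \<bullet> \<nu> q) *\<^sub>R \<nu> q"
proof -
  have n: "\<nu> q \<bullet> \<nu> q = 1" using assms by (simp add: norm_eq_sqrt_inner)
  have f: "fiber \<nu> q = {Y. \<nu> q \<bullet> Y = 0}" by (auto simp: fiber_def inner_commute)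
  have "X - (X \<bullet> \<nu> q) *\<^sub>R \<nu> q = closest_point (fiber \<nu> q) X"
  proof (rule closest_point_unique)
    show "convex (fiber \<nu> q)" "closed (fiber \<nu> q)"
      unfolding f by (rule convex_hyperplane closed_hyperplane)+
    show "X - (X \<bullet> \<nu> q) *\<^sub>R \<nu> q \<in> fiber \<nu> q"
      by (simp add: fiber_def inner_diff_left n)
    have "\<bar>X \<bullet> \<nu> q\<bar> \<le> norm (X - Y)" if "Y \<in> fiber \<nu> q" for Y
      using Cauchy_Schwarz_ineq2[of "X - Y" "\<nu> q"] that assms
      by (simp add: fiber_def inner_diff_left)
    then show "\<forall>Y\<in>fiber \<nu> q. dist X (X - (X \<bullet> \<nu> q) *\<^sub>R \<nu> q) \<le> dist X Y"
      by (simp add: dist_norm assms)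
  qed
  then show ?thesis by (simp add: fiber_proj_def)
qed

text \<open>The projection subtracts a multiple of the normal, which is already a row of the
  determinant. Thus the ordinary derivative may replace the covariant one in the geodesic
  curvature.\<close>

lemma co_orientation_fiber_proj:
  "norm (\<nu> q) = 1 \<Longrightarrow> co_orientation \<nu> q X (fiber_proj \<nu> q Y) = co_orientation \<nu> q X Y"
  by (simp add: fiber_proj_eq co_orientation_def det_3 algebra_simps)

lemma has_derivative_snd_compose:
  assumes "(g has_real_derivative g') (at y)"
  shows "((\<lambda>z. g (snd z)) has_derivative (\<lambda>h. snd h * g')) (at (l, y))"
  using has_derivative_compose[OF has_derivative_snd[OF has_derivative_ident], of g _ "(l, y)" UNIV]
    assms by (auto simp: has_field_derivative_def mult.commute)

section \<open>The front of an odd branch in terms of the support function\<close>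

locale front_data =
  fixes k :: nat and p p1 \<rho> \<rho>1 \<rho>2 :: "real \<Rightarrow> real"
  assumes odd: "odd k"
    and p: "\<And>x. (p has_real_derivative p1 x) (at x)"
    and p1: "\<And>x. (p1 has_real_derivative \<rho> x - p x) (at x)"
    and \<rho>: "\<And>x. (\<rho> has_real_derivative \<rho>1 x) (at x)"
    and \<rho>1: "\<And>x. (\<rho>1 has_real_derivative \<rho>2 x) (at x)"
    and \<rho>_pos: "\<And>x. \<rho> x > 0"
begin

definition s :: real where "s = real k * pi"

definition w :: "real \<Rightarrow> real" where "w x = p x + p (x + s)"
definition w1 :: "real \<Rightarrow> real" where "w1 x = p1 x + p1 (x + s)"
definition S :: "real \<Rightarrow> real" where "S x = \<rho> x + \<rho> (x + s)"
definition q :: "real \<Rightarrow> real" where "q x = sqrt (1 + (w x)\<^sup>2)"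
text \<open>The derivative of the front by \<theta> is A times the unit tangent, so A vanishes
  exactly on the singular set.\<close>

definition A :: "real \<Rightarrow> real \<Rightarrow> real" where "A l x = l * \<rho> x - (1 - l) * \<rho> (x + s)"
text \<open>The derivative of the first coordinate of the singular curve. Its zeros are the points
  where the null direction, that of \<theta>, is tangent to the curve.\<close>

definition \<mu> :: "real \<Rightarrow> real" where
  "\<mu> x = (\<rho>1 (x + s) * \<rho> x - \<rho> (x + s) * \<rho>1 x) / (S x)\<^sup>2"

lemma shift: "(f has_real_derivative f') (at (x + s)) \<Longrightarrow>
    ((\<lambda>x. f (x + s)) has_real_derivative f') (at x)"
  by (simp add: DERIV_shift)

lemma w_deriv: "(w has_real_derivative w1 x) (at x)"
  unfolding w_def[abs_def] w1_def by (intro DERIV_add p shift)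

lemma w1_deriv: "(w1 has_real_derivative S x - w x) (at x)"
  unfolding w1_def[abs_def] using DERIV_add[OF p1[of x] shift[OF p1[of "x + s"]]]
  by (simp add: w_def S_def algebra_simps)

lemma S_pos: "S x > 0" using \<rho>_pos by (simp add: S_def add_pos_pos)

lemma q_pos: "q x > 0" by (simp add: q_def sum_power2_gt_zero_iff add_pos_nonneg)

lemma q_sq: "q x * q x = 1 + (w x)\<^sup>2" by (simp add: q_def)

lemma q_deriv: "(q has_real_derivative w x * w1 x / q x) (at x)"
proof -
  have "1 + (w x)\<^sup>2 > 0" by (simp add: add_pos_nonneg)
  then show ?thesis
    unfolding q_def[abs_def] by (auto intro!: derivative_eq_intros w_deriv simp: field_simps)
qed

lemma deriv_p: "deriv p = p1" "deriv p1 x = \<rho> x - p x"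
  using p p1 by (auto intro!: ext DERIV_imp_deriv)

lemma curvature_eq: "curvature p x = 1 / \<rho> x"
  by (simp add: curvature_def deriv_p)

lemma trig: "cos (x + s) = - cos x" "sin (x + s) = - sin x"
  using odd by (simp_all add: s_def cos_add sin_add)

lemma width_eq: "width k p = w"
  using odd by (auto simp: width_def w_def s_def)

lemma psi_eq: "psi (wave_front k p) (l, x) (a, b) = frame x a (a * w x) (a * w1 x + b * A l x)"
proof -
  have "p differentiable at x" "deriv p differentiable at x" for x
    using p p1 by (auto simp: deriv_p real_differentiable_def)
  from psi_wave_front[OF this odd, of l x a b] show ?thesis
    unfolding s_def[symmetric] by (simp add: Let_def deriv_p frame_def A_def w_def w1_def support_curve_def trig
        vec_eq_iff forall_3 algebra_simps)
qed

lemma front_normal_eq: "front_normal k p (l, x) = frame x (w x / q x) (- 1 / q x) 0"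
  by (simp add: front_normal_def width_eq q_def frame_def vec_eq_iff forall_3)

lemma norm_front_normal: "norm (front_normal k p z) = 1"
proof -
  obtain l x where z: "z = (l, x)" by force
  have "(w x)\<^sup>2 + 1 = (q x)\<^sup>2" using q_sq[of x] by (simp add: power2_eq_square)
  then have "(w x / q x)\<^sup>2 + (1 / q x)\<^sup>2 = 1"
    using q_pos[of x] unfolding power_divide add_divide_distrib[symmetric] by simp
  then show ?thesis by (simp add: z front_normal_eq norm_frame)
qed

text \<open>The arc length density lowers the cube of the norm to its square, so that q is the only
  root left. The numerator is q times the determinant of the velocity, its derivative and the
  normal.\<close>

lemma geodesic_curvature_eq:
  assumes X: "\<And>y. psi (wave_front k p) (\<sigma> y) (velocity \<sigma> y) = frame y (a y) (b y) (d y)"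
    and \<sigma>: "snd (\<sigma> x) = x"
    and "(a has_real_derivative a') (at x)" "(b has_real_derivative b') (at x)"
    "(d has_real_derivative d') (at x)"
  shows "geodesic_curvature (wave_front k p) (front_normal k p) \<sigma> x *
      arc_density (wave_front k p) \<sigma> x =
    (a x * (d' + b x) - d x * a' + w x * (b x * (d' + b x) - d x * (b' - d x)))
       / (q x * ((a x)\<^sup>2 + (b x)\<^sup>2 + (d x)\<^sup>2))"
proof -
  obtain l where l: "\<sigma> x = (l, x)" using \<sigma> by (metis prod.collapse)
  have v: "vector_derivative (\<lambda>y. frame y (a y) (b y) (d y)) (at x) = frame x a' (b' - d x) (d' + b x)"
    by (intro vector_derivative_at frame_deriv assms)
  have "geodesic_curvature (wave_front k p) (front_normal k p) \<sigma> x =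
    (a x * (d' + b x) - d x * a' + w x * (b x * (d' + b x) - d x * (b' - d x))) / q x
       / norm (frame x (a x) (b x) (d x)) ^ 3"
    unfolding geodesic_curvature_def X Let_def cov_deriv_def v
      co_orientation_fiber_proj[OF norm_front_normal]
    unfolding co_orientation_def l front_normal_eq det_frame
    by (rule arg_cong[of _ _ "\<lambda>z. z / _"]) (use q_pos[of x] in \<open>simp add: field_simps\<close>)
  moreover have "norm (frame x (a x) (b x) (d x)) ^ 2 = (a x)\<^sup>2 + (b x)\<^sup>2 + (d x)\<^sup>2"
    by (simp add: norm_frame)
  ultimately show ?thesis
    unfolding arc_density_def X
    \<comment> \<open>At zero velocity the density annihilates the left side, and division by zero
      makes the right side 0.\<close>
    by (cases "frame x (a x) (b x) (d x) = 0") (auto simp: power3_eq_cube power2_eq_square frame_eq_0_iff)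
qed

lemma velocity_boundary: "velocity boundary_curve x = (0, 1)"
  unfolding velocity_def boundary_curve_def
  by (intro vector_derivative_at has_vector_derivative_Pair) (auto intro!: derivative_eq_intros)

lemma boundary_part_eq:
  "geodesic_curvature (wave_front k p) (front_normal k p) boundary_curve x *
      arc_density (wave_front k p) boundary_curve x = w x / q x"
proof -
  have "psi (wave_front k p) (boundary_curve y) (velocity boundary_curve y) = frame y 0 0 (\<rho> y)" for y
    unfolding velocity_boundary by (simp add: boundary_curve_def psi_eq A_def)
  moreover have "snd (boundary_curve x) = x" by (simp add: boundary_curve_def)
  ultimately show ?thesis
    using geodesic_curvature_eq[OF _ _ DERIV_const DERIV_const \<rho>] \<rho>_pos[of x]
    by (simp add: power2_eq_square)
qed

lemma singular_curve_eq: "singular_curve k p x = (\<rho> (x + s) / S x, x)"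
  unfolding singular_curve_def curvature_eq S_def s_def[symmetric]
  using \<rho>_pos[of x] \<rho>_pos[of "x + s"] by (simp add: field_simps)

lemma S_deriv: "(S has_real_derivative \<rho>1 x + \<rho>1 (x + s)) (at x)"
  unfolding S_def[abs_def] by (intro DERIV_add \<rho> shift)

lemma velocity_singular: "velocity (singular_curve k p) x = (\<mu> x, 1)"
proof -
  have "((\<lambda>x. \<rho> (x + s) / S x) has_real_derivative \<mu> x) (at x)"
    using S_pos[of x]
    by (auto intro!: derivative_eq_intros shift[OF \<rho>] \<rho> S_deriv simp: \<mu>_def S_def power2_eq_square algebra_simps)
  then show ?thesis
    unfolding velocity_def singular_curve_eq[abs_def]
    by (intro vector_derivative_at has_vector_derivative_Pair)
       (auto simp: has_real_derivative_iff_has_vector_derivative)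
qed

lemma A_singular: "A (\<rho> (x + s) / S x) x = 0"
  using S_pos[of x] by (simp add: A_def field_simps) (simp add: S_def algebra_simps)

lemma psi_singular:
  "psi (wave_front k p) (singular_curve k p x) (a, b) = frame x a (a * w x) (a * w1 x)"
  by (simp add: singular_curve_eq psi_eq A_singular)

lemma lambda_psi_eq: "lambda_psi (wave_front k p) (front_normal k p) = (\<lambda>z. A (fst z) (snd z) * q (snd z))"
proof
  fix z :: "real \<times> real"
  obtain l x where z: "z = (l, x)" by force
  have "lambda_psi (wave_front k p) (front_normal k p) z = A l x * (1 + (w x)\<^sup>2) / q x"
    unfolding z lambda_psi_def psi_eq co_orientation_def front_normal_eq det_frame
    using q_pos[of x] by (simp add: field_simps power2_eq_square)
  then show "lambda_psi (wave_front k p) (front_normal k p) z = A (fst z) (snd z) * q (snd z)"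
    using q_pos[of x] by (simp add: z q_sq[symmetric])
qed

text \<open>On the singular curve A = 0, so the derivative of q drops out of that of A q.
  Differentiating A(\<lambda>(\<theta>), \<theta>) = 0, where A_\<lambda> = S, gives A_\<theta> = -
  \<mu> S.\<close>

lemma lambda_psi_deriv:
  "frechet_derivative (lambda_psi (wave_front k p) (front_normal k p)) (at (singular_curve k p x)) (0, b)
     = - (b * \<mu> x * S x * q x)"
proof -
  let ?l = "\<rho> (x + s) / S x"
  have 1: "?l * \<rho> x - (1 - ?l) * \<rho> (x + s) = 0" using A_singular by (simp add: A_def)
  have 2: "?l * \<rho>1 x - (1 - ?l) * \<rho>1 (x + s) = - \<mu> x * S x"
    using S_pos[of x] by (simp add: \<mu>_def field_simps power2_eq_square) (simp add: S_def algebra_simps)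
  note d = has_derivative_snd_compose[OF \<rho>[of x]] has_derivative_snd_compose[OF q_deriv[of x]]
    has_derivative_snd_compose[OF shift[OF \<rho>[of "x + s"]]]
  have "((\<lambda>z. A (fst z) (snd z) * q (snd z)) has_derivative
     (\<lambda>h. (?l * \<rho> x - (1 - ?l) * \<rho> (x + s)) * (snd h * (w x * w1 x / q x)) +
       (fst h * \<rho> x + ?l * (snd h * \<rho>1 x) + fst h * \<rho> (x + s) - (1 - ?l) * (snd h * \<rho>1 (x + s))) * q x))
     (at (?l, x))"
    unfolding A_def
    by (rule derivative_eq_intros d refl | rule ext | simp add: algebra_simps)+
  from fun_cong[OF frechet_derivative_at[OF this], of "(0, b)"]
  have "frechet_derivative (lambda_psi (wave_front k p) (front_normal k p)) (at (singular_curve k p x)) (0, b)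
     = (?l * (b * \<rho>1 x) - (1 - ?l) * (b * \<rho>1 (x + s))) * q x"
    unfolding lambda_psi_eq singular_curve_eq 1 by simp
  also have "\<dots> = b * (?l * \<rho>1 x - (1 - ?l) * \<rho>1 (x + s)) * q x"
    by (simp add: algebra_simps)
  finally show ?thesis unfolding 2 by simp
qed

lemma \<mu>_differentiable: "\<exists>\<mu>'. (\<mu> has_real_derivative \<mu>') (at x)"
  unfolding \<mu>_def[abs_def] using S_pos[of x]
  by (auto intro!: exI derivative_eq_intros shift[OF \<rho>] shift[OF \<rho>1] \<rho> \<rho>1 S_deriv)

text \<open>The kernel is spanned by (0, 1), and positive orientation of (\<mu>, 1) and (0, b) means
  b \<mu> > 0. Hence \<open>lambda_psi\<close> decreases along the null vector whatever the sign of
  \<mu>. The velocity has frame coordinates \<mu> (1, w, w1), and the factor \<mu>^2 cancels; the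
  result extends continuously across the zeros of \<mu>.\<close>

lemma singular_part_eq:
  assumes nz: "\<mu> x \<noteq> 0"
  shows "singular_curvature (wave_front k p) (front_normal k p) (singular_curve k p) x *
      arc_density (wave_front k p) (singular_curve k p) x
    = - (S x * q x / (1 + (w x)\<^sup>2 + (w1 x)\<^sup>2))"
proof -
  let ?f = "wave_front k p" and ?\<sigma> = "singular_curve k p"
  define \<eta> where "\<eta> = null_vector ?f ?\<sigma> x"
  \<comment> \<open>With the factor \<mu> x in the witness, the orientation determinant is a
    square.\<close>
  have "psi ?f (?\<sigma> x) (0, \<mu> x) = 0 \<and> positively_oriented (velocity ?\<sigma> x) (0, \<mu> x)"
    using nz by (auto simp: psi_singular frame_eq_0_iff velocity_singular positively_oriented_def
        zero_less_mult_iff)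
  then have "psi ?f (?\<sigma> x) \<eta> = 0 \<and> positively_oriented (velocity ?\<sigma> x) \<eta>"
    unfolding \<eta>_def null_vector_def by (rule someI)
  then obtain b where b: "\<eta> = (0, b)" "b * \<mu> x > 0"
    by (cases \<eta>) (auto simp: psi_singular frame_eq_0_iff velocity_singular positively_oriented_def mult.commute)
  have sg: "sgn (frechet_derivative (lambda_psi ?f (front_normal k p)) (at (?\<sigma> x)) \<eta>) = - 1"
    unfolding b lambda_psi_deriv using b(2) S_pos[of x] q_pos[of x]
    by (simp add: sgn_minus zero_less_mult_iff)
  obtain \<mu>' where \<mu>': "(\<mu> has_real_derivative \<mu>') (at x)" using \<mu>_differentiable by blast
  have "psi ?f (?\<sigma> y) (velocity ?\<sigma> y) = frame y (\<mu> y) (\<mu> y * w y) (\<mu> y * w1 y)" for y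
    by (simp add: velocity_singular psi_singular)
  note g = geodesic_curvature_eq[OF this _ \<mu>' DERIV_mult[OF \<mu>' w_deriv] DERIV_mult[OF \<mu>' w1_deriv]]
  have "geodesic_curvature ?f (front_normal k p) ?\<sigma> x * arc_density ?f ?\<sigma> x
      = ((\<mu> x)\<^sup>2 * S x * (1 + (w x)\<^sup>2)) / (q x * ((\<mu> x)\<^sup>2 * (1 + (w x)\<^sup>2 + (w1 x)\<^sup>2)))"
    by (subst g) (simp_all add: singular_curve_eq algebra_simps power2_eq_square)
  also have "\<dots> = S x * q x / (1 + (w x)\<^sup>2 + (w1 x)\<^sup>2)"
    using nz q_pos[of x] unfolding q_sq[symmetric] by (simp add: divide_simps)
  finally show ?thesis
    unfolding singular_curvature_def \<eta>_def[symmetric] sg by simp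
qed

text \<open>At a zero of \<mu> the density, and with it f, is 0, whereas the continuous function h
  is negative. The zeros must be null for h to replace f under the integral.\<close>

lemma gauss_bonnet:
  assumes null: "negligible {x \<in> {0..T}. \<mu> x = 0}" and T: "T \<ge> 0"
    and period: "\<And>x. p (x + T) = p x"
  defines "f \<equiv> \<lambda>x. singular_curvature (wave_front k p) (front_normal k p) (singular_curve k p) x *
      arc_density (wave_front k p) (singular_curve k p) x"
    and "g \<equiv> \<lambda>x. geodesic_curvature (wave_front k p) (front_normal k p) boundary_curve x *
      arc_density (wave_front k p) boundary_curve x"
  shows "f absolutely_integrable_on {0..T}" "g absolutely_integrable_on {0..T}"
    "integral {0..T} f + integral {0..T} g = 0"
proof -
  define h where "h x = - (S x * q x / (1 + (w x)\<^sup>2 + (w1 x)\<^sup>2))" for x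
  have pos: "1 + (w x)\<^sup>2 + (w1 x)\<^sup>2 > 0" for x by (simp add: add_pos_nonneg)
  have g: "g = (\<lambda>x. w x / q x)" by (simp add: g_def boundary_part_eq)
  have cont: "continuous_on {0..T} w" "continuous_on {0..T} w1" "continuous_on {0..T} q"
    "continuous_on {0..T} S"
    using w_deriv w1_deriv q_deriv S_deriv by (meson DERIV_isCont continuous_at_imp_continuous_on)+
  have ig: "g absolutely_integrable_on {0..T}"
    unfolding g using q_pos
    by (intro absolutely_integrable_continuous_real continuous_intros cont) (metis less_irrefl)
  have ih: "h absolutely_integrable_on {0..T}"
    unfolding h_def using pos
    by (intro absolutely_integrable_continuous_real continuous_intros cont) (metis less_irrefl)
  have fh: "f x = h x" if "x \<in> {0..T} - {x \<in> {0..T}. \<mu> x = 0}" for x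
    using that singular_part_eq[of x] by (simp add: f_def h_def)
  show if': "f absolutely_integrable_on {0..T}"
    by (rule absolutely_integrable_spike[OF ih null fh])
  show "g absolutely_integrable_on {0..T}" by (fact ig)
  \<comment> \<open>In frame coordinates w1 / q is the tangent of the angle between (1, w, 0) and
    the singular direction (1, w, w1); the boundary direction is orthogonal to (1, w, 0) in the same
    fiber.\<close>
  have "((\<lambda>x. - arctan (w1 x / q x)) has_real_derivative h x + g x) (at x)" for x
  proof -
    have "1 + (w1 x / q x)\<^sup>2 = (1 + (w x)\<^sup>2 + (w1 x)\<^sup>2) / (q x * q x)"
      using q_pos[of x] unfolding q_sq[symmetric] by (simp add: field_simps power2_eq_square)
    then have e: "inverse (1 + (w1 x / q x)\<^sup>2) = (q x * q x) / (1 + (w x)\<^sup>2 + (w1 x)\<^sup>2)"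
      by simp
    have "h x + g x = (w x * (1 + (w x)\<^sup>2 + (w1 x)\<^sup>2) - S x * (q x * q x)) / (q x * (1 + (w x)\<^sup>2 + (w1 x)\<^sup>2))"
      using q_pos[of x] pos[of x] by (simp add: h_def g field_simps)
    also have "\<dots> = - (((S x - w x) * q x - w1 x * (w x * w1 x / q x)) / (q x * q x)
        * inverse (1 + (w1 x / q x)\<^sup>2))"
    proof -
      have "((S x - w x) * q x - w1 x * (w x * w1 x / q x)) / (q x * q x)
          * inverse (1 + (w1 x / q x)\<^sup>2)
        = ((S x - w x) * (q x * q x) - w x * (w1 x)\<^sup>2) / (q x * (1 + (w x)\<^sup>2 + (w1 x)\<^sup>2))"
        unfolding e using q_pos[of x] pos[of x] by (simp add: divide_simps power2_eq_square)
      then show ?thesis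
        by (simp only: minus_divide_left q_sq) (simp add: algebra_simps)
    qed
    finally show ?thesis
      using q_pos[of x] by (auto intro!: derivative_eq_intros w1_deriv q_deriv)
  qed
  then have "((\<lambda>x. h x + g x) has_integral - arctan (w1 T / q T) - - arctan (w1 0 / q 0)) {0..T}"
    using T by (intro fundamental_theorem_of_calculus)
      (auto simp: has_real_derivative_iff_has_vector_derivative intro: has_vector_derivative_at_within)
  moreover have "w1 T / q T = w1 0 / q 0"
  proof -
    have "((\<lambda>x. p (x + T)) has_real_derivative p1 (x + T)) (at x)" for x
      using p[of "x + T"] by (simp add: DERIV_shift)
    then have "p1 (x + T) = p1 x" for x
      using p DERIV_unique unfolding period by blast
    from this[of 0] this[of s] period[of 0] period[of s] show ?thesis
      by (simp add: w1_def q_def w_def add.commute)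
  qed
  ultimately have "integral {0..T} (\<lambda>x. h x + g x) = 0" by (simp add: integral_unique)
  moreover have "integral {0..T} (\<lambda>x. h x + g x) = integral {0..T} h + integral {0..T} g"
    using ih ig by (intro integral_add) (auto simp: absolutely_integrable_on_def)
  moreover have "integral {0..T} f = integral {0..T} h"
    by (rule integral_spike[OF null]) (use fh in auto)
  ultimately show "integral {0..T} f + integral {0..T} g = 0" by simp
qed

end

section \<open>Null directions tangent to the singular curve\<close>

text \<open>The unions of the tails decrease to the limsup inside K, which has finite measure, so
  continuity from above applies. It serves twice: for curves that converge to a given one, and for a
  family of perturbations.\<close>

lemma measure_limsup_less:
  fixes Z :: "nat \<Rightarrow> 'a::euclidean_space set"
  assumes Z: "\<And>j. Z j \<in> sets lebesgue" and K: "K \<in> lmeasurable" and B: "B \<in> lmeasurable"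
    and limsup: "{x \<in> K. \<forall>i. \<exists>j\<ge>i. x \<in> Z j} \<subseteq> B" and less: "measure lebesgue B < e"
  shows "\<exists>j. measure lebesgue (Z j \<inter> K) < e"
proof -
  define A where "A i = (\<Union>j\<in>{i..}. Z j \<inter> K)" for i :: nat
  have A: "A i \<in> sets lebesgue" for i unfolding A_def using Z K by auto
  have lm: "A i \<in> lmeasurable" for i
    by (rule fmeasurableI2[OF K _ A]) (auto simp: A_def)
  have "decseq A" by (force simp: decseq_def A_def)
  then have "(\<lambda>i. measure lebesgue (A i)) \<longlonglongrightarrow> measure lebesgue (\<Inter>i. A i)"
    using A fmeasurableD2[OF lm]
    by (intro Lim_measure_decseq) (simp_all only: infinity_ennreal_def image_subset_iff ball_simps simp_thms)
  moreover have "measure lebesgue (\<Inter>i. A i) < e"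
  proof -
    have "(\<Inter>i. A i) \<subseteq> B" using limsup by (force simp: A_def)
    moreover have "(\<Inter>i. A i) \<in> sets lebesgue" using A by auto
    ultimately show ?thesis
      using measure_mono_fmeasurable[OF _ _ B] less by (meson le_less_trans)
  qed
  ultimately have "eventually (\<lambda>i. measure lebesgue (A i) < e) sequentially"
    by (rule order_tendstoD(2))
  then obtain i where i: "measure lebesgue (A i) < e"
    by (auto simp: eventually_sequentially)
  have "measure lebesgue (Z i \<inter> K) \<le> measure lebesgue (A i)"
    using Z[of i] K lm by (intro measure_mono_fmeasurable) (auto simp: A_def)
  with i show ?thesis by (intro exI[of _ i]) simp
qed

text \<open>For a rosette these are the zeros of the derivative of \<lambda>_k. They are counted
  from \<theta> 0, so that all normal angles yield one set and the sets of nearby curves can be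
  compared.\<close>

definition flat_angles :: "nat \<Rightarrow> (real \<Rightarrow> real^2) \<Rightarrow> real set" where
  "flat_angles k c = {x. \<exists>\<theta> s t. normal_angle c \<theta> \<and> \<theta> s = \<theta> 0 + x \<and>
     \<theta> t = \<theta> 0 + x + real k * pi \<and> log_rate c s = log_rate c t}"

context rosette_angle
begin

lemma flat_angles_param:
  "flat_angles k c = {x. log_rate c (param (\<theta> 0 + x)) = log_rate c (param (\<theta> 0 + x + real k * pi))}"
proof -
  have "log_rate c (param (\<theta> 0 + x)) = log_rate c (param (\<theta> 0 + x + real k * pi))"
    if \<phi>: "normal_angle c \<phi>" and st: "\<phi> s = \<phi> 0 + x" "\<phi> t = \<phi> 0 + x + real k * pi"
      and eq: "log_rate c s = log_rate c t" for \<phi> s t x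
  proof -
    have "\<phi> u - \<theta> u = \<phi> 0 - \<theta> 0" for u
      by (rule DERIV_zero_diff_const[OF normal_angle_has_real_derivative[OF smooth regular \<phi>] angle_deriv])
    from this[of s] this[of t] st have "\<theta> s = \<theta> 0 + x" "\<theta> t = \<theta> 0 + x + real k * pi" by simp_all
    then show ?thesis using eq param_angle by metis
  qed
  then show ?thesis
    unfolding flat_angles_def using angle angle_param by blast
qed

text \<open>Clearing denominators turns the equality of logarithmic derivatives into a vanishing
  Wronskian of \<rho> and its translate. As in \<open>log_rate_eq\<close>, \<rho> may be the radius
  of a perturbed curve.\<close>

lemma flat_angles_eq:
  assumes speed: "\<And>t. norm (vderiv 1 c t) = \<rho> (\<theta> t) * turning c t"
    and \<rho>: "\<And>x. (\<rho> has_real_derivative \<rho>' x) (at x)"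
  shows "flat_angles k c = {x. \<rho>' (\<theta> 0 + x) * \<rho> (\<theta> 0 + x + real k * pi)
    - \<rho> (\<theta> 0 + x) * \<rho>' (\<theta> 0 + x + real k * pi) = 0}"
proof -
  have nz: "\<rho> x \<noteq> 0" for x using speed[of "param x"] regular[of "param x"] by auto
  have "log_rate c (param x) = \<rho>' x / \<rho> x" for x
    using log_rate_eq[OF smooth regular angle speed \<rho>, of "param x"] by simp
  then have "log_rate c (param x) = log_rate c (param y) \<longleftrightarrow> \<rho>' x * \<rho> y - \<rho> x * \<rho>' y = 0" for x y
    using nz[of x] nz[of y] by (simp add: field_simps)
  then show ?thesis by (simp only: flat_angles_param)
qed

lemma flat_angles_closed: "closed (flat_angles k c)"
proof -
  have r: "(radius has_real_derivative vderiv 1 radius x) (at x)" for x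
    using smooth_curve_has_vderiv[OF smooth_radius, of 0 x]
    by (simp add: has_real_derivative_iff_has_vector_derivative)
  have c: "continuous_on UNIV radius" "continuous_on UNIV (vderiv 1 radius)"
    using continuous_on_vderiv[OF smooth_radius, of UNIV 0] continuous_on_vderiv[OF smooth_radius, of UNIV 1]
    by simp_all
  show ?thesis
    unfolding flat_angles_eq[OF speed_radius r]
    by (intro closed_Collect_eq continuous_intros continuous_on_compose2[OF c(1)]
        continuous_on_compose2[OF c(2)]) auto
qed

end

section \<open>Sequences of rosettes that converge together with three derivatives\<close>

locale rosette_limit = rosette_angle m c \<theta> for m c \<theta> +
  fixes d :: "nat \<Rightarrow> real \<Rightarrow> real^2" and \<phi> :: "nat \<Rightarrow> real \<Rightarrow> real"
  assumes rosette_d: "\<And>j. rosette_angle m (d j) (\<phi> j)"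
    and close: "\<And>i j t. i \<le> 3 \<Longrightarrow> norm (vderiv i (d j) t - vderiv i c t) < 1 / real (Suc j)"
begin

lemma uniform_vderiv: "i \<le> 3 \<Longrightarrow> uniform_limit U (\<lambda>j. vderiv i (d j)) (vderiv i c) sequentially"
proof (rule uniform_limitI)
  fix e :: real assume "i \<le> 3" "e > 0"
  have "eventually (\<lambda>j. 1 / real (Suc j) < e) sequentially"
    using LIMSEQ_inverse_real_of_nat \<open>e > 0\<close> by (auto dest!: order_tendstoD(2) simp: inverse_eq_divide)
  then show "eventually (\<lambda>j. \<forall>t\<in>U. dist (vderiv i (d j) t) (vderiv i c t) < e) sequentially"
    by eventually_elim (auto simp only: dist_norm intro: less_trans[OF close[OF \<open>i \<le> 3\<close>]])
qed

lemma tendsto_vderiv: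
  assumes i: "i \<le> 3" and s: "s \<longlonglongrightarrow> t"
  shows "(\<lambda>j. vderiv i (d j) (s j)) \<longlonglongrightarrow> vderiv i c t"
proof -
  have "(\<lambda>j. vderiv i c (s j)) \<longlonglongrightarrow> vderiv i c t"
    using continuous_on_tendsto_compose[OF continuous_on_vderiv[OF smooth, of UNIV i] s] by simp
  moreover have "(\<lambda>j. vderiv i (d j) (s j) - vderiv i c (s j)) \<longlonglongrightarrow> 0"
    by (rule Lim_null_comparison[OF _ LIMSEQ_inverse_real_of_nat])
       (use close[OF i] in \<open>auto simp: inverse_eq_divide intro!: less_imp_le always_eventually\<close>)
  ultimately show ?thesis by (rule Lim_transform)
qed

lemma tendsto_log_rate:
  assumes "s \<longlonglongrightarrow> t"
  shows "(\<lambda>j. log_rate (d j) (s j)) \<longlonglongrightarrow> log_rate c t"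
proof -
  note t = tendsto_vderiv[OF _ assms]
  show ?thesis
    unfolding log_rate_def using cross2_pos[of t]
    by (intro tendsto_diff tendsto_divide tendsto_mult tendsto_const tendsto_power
        bounded_bilinear.tendsto[OF bounded_bilinear_cross2] tendsto_inner t) simp_all
qed

text \<open>Only increments can converge, because each \<phi> j is determined up to a multiple of 2
  pi. Their derivatives converge uniformly on an interval around 0 and t, and the mean value
  inequality does the rest.\<close>

lemma tendsto_angle: "(\<lambda>j. \<phi> j t - \<phi> j 0) \<longlonglongrightarrow> \<theta> t - \<theta> 0"
proof -
  define U where "U = {- \<bar>t\<bar>..\<bar>t\<bar>}"
  have bdd: "bounded (f ` U)" if "continuous_on U f" for f :: "real \<Rightarrow> 'a::metric_space"
    using that by (intro compact_imp_bounded compact_continuous_image) (auto simp: U_def)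
  have co: "continuous_on U (vderiv i c)" for i by (rule continuous_on_vderiv[OF smooth])
  have co2: "continuous_on U (\<lambda>t. cross2 (vderiv 1 c t) (vderiv 2 c t))"
    "continuous_on U (\<lambda>t. vderiv 1 c t \<bullet> vderiv 1 c t)"
    by (intro continuous_intros co bounded_bilinear.continuous_on[OF bounded_bilinear_cross2])+
  \<comment> \<open>A quotient of uniform limits requires a denominator bounded away from 0.\<close>
  obtain b where b: "b > 0" "\<And>t. t \<in> U \<Longrightarrow> b \<le> norm (vderiv 1 c t \<bullet> vderiv 1 c t)"
  proof -
    obtain u where "u \<in> U" "\<forall>t\<in>U. vderiv 1 c u \<bullet> vderiv 1 c u \<le> vderiv 1 c t \<bullet> vderiv 1 c t"
      using continuous_attains_inf[OF _ _ co2(2)] by (auto simp: U_def)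
    then show ?thesis using regular[of u] that[of "vderiv 1 c u \<bullet> vderiv 1 c u"] by simp
  qed
  have "uniform_limit U (\<lambda>j t. cross2 (vderiv 1 (d j) t) (vderiv 2 (d j) t)
      / (vderiv 1 (d j) t \<bullet> vderiv 1 (d j) t))
    (\<lambda>t. cross2 (vderiv 1 c t) (vderiv 2 c t) / (vderiv 1 c t \<bullet> vderiv 1 c t)) sequentially"
    by (rule uniform_lim_divide[OF
          bounded_bilinear.bounded_uniform_limit[OF bounded_bilinear_cross2]
          bounded_bilinear.bounded_uniform_limit[OF bounded_bilinear_inner] _ b(2,1)])
       (auto intro!: uniform_vderiv bdd co co2 simp del: One_nat_def)
  then have ul: "uniform_limit U (\<lambda>j. turning (d j)) (turning c) sequentially"
    by (simp add: turning_def[abs_def])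
  show ?thesis
  proof (rule tendstoI)
    fix e :: real assume "e > 0"
    have "eventually (\<lambda>j. \<forall>u\<in>U. dist (turning (d j) u) (turning c u) < e / (1 + \<bar>t\<bar>)) sequentially"
      by (rule uniform_limitD[OF ul]) (use \<open>e > 0\<close> in auto)
    then show "eventually (\<lambda>j. dist (\<phi> j t - \<phi> j 0) (\<theta> t - \<theta> 0) < e) sequentially"
    proof eventually_elim
      case (elim j)
      interpret d: rosette_angle m "d j" "\<phi> j" by (rule rosette_d)
      have "norm ((\<phi> j t - \<theta> t) - (\<phi> j 0 - \<theta> 0)) \<le> e / (1 + \<bar>t\<bar>) * norm (t - 0)"
      proof (rule field_differentiable_bound)
        show "((\<lambda>t. \<phi> j t - \<theta> t) has_field_derivative turning (d j) u - turning c u) (at u within U)" for u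
          by (intro DERIV_diff DERIV_subset[OF d.angle_deriv] DERIV_subset[OF angle_deriv]) auto
        show "norm (turning (d j) u - turning c u) \<le> e / (1 + \<bar>t\<bar>)" if "u \<in> U" for u
          using elim that by (auto simp: dist_norm intro: less_imp_le)
      qed (auto simp: U_def)
      also have "\<dots> < e" using \<open>e > 0\<close> by (simp add: field_simps)
      finally show ?case by (simp add: dist_norm algebra_simps)
    qed
  qed
qed

text \<open>Pointwise convergence of increasing functions passes to their inverses: the limits at s
  - e and s + e lie strictly on either side of the target, hence so do the values for late
  j.\<close>

lemma tendsto_param:
  "(\<lambda>j. rosette_angle.param (\<phi> j) (\<phi> j 0 + x)) \<longlonglongrightarrow> param (\<theta> 0 + x)"
proof (rule tendstoI)
  fix e :: real assume "e > 0"
  let ?s = "param (\<theta> 0 + x)"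
  have "\<theta> (?s - e) - \<theta> 0 < x" "x < \<theta> (?s + e) - \<theta> 0"
    using strict_monoD[OF strict_mono_angle, of "?s - e" ?s]
      strict_monoD[OF strict_mono_angle, of ?s "?s + e"] \<open>e > 0\<close> by auto
  then have "eventually (\<lambda>j. \<phi> j (?s - e) - \<phi> j 0 < x) sequentially"
    "eventually (\<lambda>j. x < \<phi> j (?s + e) - \<phi> j 0) sequentially"
    by (auto intro: order_tendstoD[OF tendsto_angle])
  then show "eventually (\<lambda>j. dist (rosette_angle.param (\<phi> j) (\<phi> j 0 + x)) ?s < e) sequentially"
  proof eventually_elim
    case (elim j)
    interpret d: rosette_angle m "d j" "\<phi> j" by (rule rosette_d)
    have "\<phi> j (?s - e) < \<phi> j (d.param (\<phi> j 0 + x))" "\<phi> j (d.param (\<phi> j 0 + x)) < \<phi> j (?s + e)"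
      using elim by auto
    then show ?case
      unfolding strict_mono_less[OF d.strict_mono_angle] dist_real_def by linarith
  qed
qed

text \<open>Both sides of the defining equation converge, and an equality that holds for infinitely
  many j survives in the limit.\<close>

lemma limsup_flat_angles:
  assumes x: "\<forall>i. \<exists>j\<ge>i. x \<in> flat_angles k (d j)"
  shows "x \<in> flat_angles k c"
proof -
  define a where "a y j = log_rate (d j) (rosette_angle.param (\<phi> j) (\<phi> j 0 + y))" for y j
  have a: "a y \<longlonglongrightarrow> log_rate c (param (\<theta> 0 + y))" for y
    unfolding a_def by (rule tendsto_log_rate[OF tendsto_param])
  let ?y = "x + real k * pi"
  have "frequently (\<lambda>j. a x j = a ?y j) sequentially"
    unfolding frequently_sequentially
    using x rosette_angle.flat_angles_param[OF rosette_d] by (simp add: a_def add.assoc)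
  moreover have "eventually (\<lambda>j. a x j \<noteq> a ?y j) sequentially"
    if "log_rate c (param (\<theta> 0 + x)) \<noteq> log_rate c (param (\<theta> 0 + ?y))"
    using tendsto_imp_eventually_ne[OF tendsto_diff[OF a[of x] a[of ?y]], of 0] that by simp
  ultimately show ?thesis
    by (auto simp: flat_angles_param add.assoc frequently_def)
qed

end

section \<open>Genericity\<close>

lemma range_periodic:
  assumes per: "\<And>t. f (t + 1) = f (t::real)"
  shows "range f = f ` {0..1}"
proof -
  have n: "f (t + real n) = f t" for t n
  proof (induction n)
    case (Suc n)
    then show ?case using per[of "t + real n"] by (simp add: algebra_simps)
  qed simp
  have "f t = f (frac t)" for t
  proof (cases "\<lfloor>t\<rfloor> \<ge> 0")
    case True
    then show ?thesis using n[of "frac t" "nat \<lfloor>t\<rfloor>"] by (simp add: frac_def)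
  next
    case False
    then show ?thesis using n[of t "nat (- \<lfloor>t\<rfloor>)"] by (simp add: frac_def)
  qed
  then show ?thesis
    by (auto simp: image_iff intro!: bexI[of _ "frac _"] less_imp_le[OF frac_lt_1])
qed

text \<open>\<open>Cinf_nbhd\<close> demands bounds on the whole line; periodicity reduces them to a
  compact interval.\<close>

lemma bounded_vderiv_periodic:
  fixes f :: "real \<Rightarrow> 'a::real_normed_vector"
  assumes f: "smooth_curve f" and per: "\<And>t. f (t + 1) = f t"
  shows "\<exists>B>0. \<forall>i\<le>N. \<forall>t. norm (vderiv i f t) \<le> B"
proof -
  have "bounded (range (vderiv i f))" for i
    unfolding range_periodic[of "vderiv i f", OF vderiv_periodic[OF f per]]
    by (intro compact_imp_bounded compact_continuous_image continuous_on_vderiv f) auto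
  then have "bounded (\<Union>i\<in>{..N}. range (vderiv i f))"
    by (intro bounded_UN) auto
  then show ?thesis
    unfolding bounded_pos by auto
qed

lemma vderiv_add_scaleR:
  assumes c: "smooth_curve c" and d: "smooth_curve d"
  shows "vderiv n (\<lambda>u. c u + t *\<^sub>R d u) u = vderiv n c u + t *\<^sub>R vderiv n d u"
proof (induction n arbitrary: u)
  case (Suc n)
  have "((\<lambda>u. vderiv n c u + t *\<^sub>R vderiv n d u) has_vector_derivative
      vderiv (Suc n) c u + t *\<^sub>R vderiv (Suc n) d u) (at u)"
    by (intro has_vector_derivative_add smooth_curve_has_vderiv c d
        bounded_linear.has_vector_derivative[OF bounded_linear_scaleR_right])
  then show ?case
    by (simp add: vderiv_Suc[of n "\<lambda>u. c u + t *\<^sub>R d u"] Suc.IH[abs_def] vector_derivative_at)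
qed simp

lemma negligible_cos_level:
  fixes r b v :: real
  assumes "r \<noteq> 0"
  shows "negligible {x. cos (r * x + b) = v}"
proof (cases "\<exists>y. cos y = v")
  case True
  then obtain y where y: "cos y = v" by blast
  have "{x. cos (r * x + b) = v} \<subseteq> (\<lambda>z. (z - b) / r) `
      ((\<lambda>n. y + 2 * of_int n * pi) ` UNIV \<union> (\<lambda>n. - y + 2 * of_int n * pi) ` UNIV)"
  proof
    fix x assume "x \<in> {x. cos (r * x + b) = v}"
    then have "\<exists>n\<in>\<int>. r * x + b = y + 2 * n * pi \<or> r * x + b = - y + 2 * n * pi"
      using cos_eq[of "r * x + b" y] y by simp
    then obtain n :: int where "r * x + b = y + 2 * of_int n * pi \<or> r * x + b = - y + 2 * of_int n * pi"
      unfolding Ints_def by auto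
    then have "r * x + b \<in> range (\<lambda>n::int. y + 2 * of_int n * pi) \<union> range (\<lambda>n::int. - y + 2 * of_int n * pi)"
      by auto
    moreover have "x = ((r * x + b) - b) / r" using assms by simp
    ultimately show "x \<in> (\<lambda>z. (z - b) / r) `
      ((\<lambda>n. y + 2 * of_int n * pi) ` UNIV \<union> (\<lambda>n. - y + 2 * of_int n * pi) ` UNIV)"
      by blast
  qed
  moreover have "countable ((\<lambda>z. (z - b) / r) `
      (range (\<lambda>n::int. y + 2 * of_int n * pi) \<union> range (\<lambda>n::int. - y + 2 * of_int n * pi)))"
    by auto
  ultimately show ?thesis
    by (metis countable_subset countable_imp_null_set_lborel null_sets_completionI negligible_iff_null_sets)
qed simp

lemma finite_quadratic_roots:
  fixes a b c :: real
  assumes "a \<noteq> 0"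
  shows "finite {t. c + t * b + t\<^sup>2 * a = 0}"
proof -
  have "{t. c + t * b + t\<^sup>2 * a = 0} = {t. poly [:c, b, a:] t = 0}"
    by (simp add: power2_eq_square algebra_simps)
  also have "finite \<dots>" by (rule poly_roots_finite) (simp add: assms)
  finally show ?thesis .
qed

section \<open>Perturbations that keep the normal angle\<close>

context rosette_angle
begin

text \<open>A multiple of 1/m, so that the perturbation closes up after m turns. It stays away from
  1, where \<open>bump_radius\<close> would be constant; the odd numerator serves the parity
  argument in \<open>negligible_bump_wronskian\<close>.\<close>

definition freq :: real where "freq = (2 * real m + 1) / real m"

text \<open>The curve with support function h = 1 + cos (freq x) in the normal angle;
  \<open>bump_radius\<close> is h + h''. The constant 1 matters: for the cosine alone the Wronskian
  with the translate by k \<pi> would be a multiple of sin (freq k \<pi>), which is 0 for k =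
  m.\<close>

definition bump :: "real \<Rightarrow> real^2" where
  "bump u = (1 + cos (freq * \<theta> u)) *\<^sub>R unit_normal (\<theta> u) - (freq * sin (freq * \<theta> u)) *\<^sub>R unit_tangent (\<theta> u)"

definition bump_radius :: "real \<Rightarrow> real" where
  "bump_radius x = 1 + (1 - freq\<^sup>2) * cos (freq * x)"

lemma freq_gt: "freq > 2"
  using m by (simp add: freq_def field_simps)

lemma smooth_bump: "smooth_curve bump"
  unfolding bump_def[abs_def] diff_conv_add_uminus
  by (intro smooth_curve_add smooth_curve_scaleR smooth_curve_mult smooth_curve_const smooth_unit
      smooth_curve_sin smooth_curve_cos smooth_angle
      smooth_curve_linear[OF bounded_linear_minus[OF bounded_linear_ident]])

lemma bump_period: "bump (u + 1) = bump u"
proof -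
  have e: "freq * (\<theta> u + 2 * pi * real m) = freq * \<theta> u + 2 * pi * real (2 * m + 1)"
    using m by (simp add: freq_def field_simps)
  have t: "cos (x + 2 * pi * real n) = cos x" "sin (x + 2 * pi * real n) = sin x" for x n
    using sin.plus_of_nat[of x n] cos.plus_of_nat[of x n] by (simp_all add: mult_ac)
  show ?thesis
    unfolding bump_def angle_period e t unit_normal_def unit_tangent_def ..
qed

lemma bump_deriv:
  "(bump has_vector_derivative (bump_radius (\<theta> u) * turning c u) *\<^sub>R unit_tangent (\<theta> u)) (at u)"
proof -
  note th = angle_deriv[unfolded has_real_derivative_iff_has_vector_derivative]
  have n: "((\<lambda>u. unit_normal (\<theta> u)) has_vector_derivative turning c u *\<^sub>R unit_tangent (\<theta> u)) (at u)"
    using vector_diff_chain_at[OF th unit_normal_deriv] by (simp add: o_def)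
  have t: "((\<lambda>u. unit_tangent (\<theta> u)) has_vector_derivative turning c u *\<^sub>R - unit_normal (\<theta> u)) (at u)"
    using vector_diff_chain_at[OF th unit_tangent_deriv] by (simp add: o_def)
  have "((\<lambda>u. 1 + cos (freq * \<theta> u)) has_real_derivative - freq * turning c u * sin (freq * \<theta> u)) (at u)"
    "((\<lambda>u. freq * sin (freq * \<theta> u)) has_real_derivative freq\<^sup>2 * turning c u * cos (freq * \<theta> u)) (at u)"
    by (auto intro!: derivative_eq_intros angle_deriv simp: power2_eq_square)
  from has_vector_derivative_diff[OF has_vector_derivative_scaleR[OF this(1) n]
      has_vector_derivative_scaleR[OF this(2) t]]
  show ?thesis
    unfolding bump_def[abs_def]
    by (rule has_vector_derivative_eq_rhs)
       (simp add: vec_eq_iff forall_2 unit_normal_def unit_tangent_def bump_radius_def algebra_simps power2_eq_square)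
qed

lemma vderiv_1_bump: "vderiv 1 bump u = (bump_radius (\<theta> u) * turning c u) *\<^sub>R unit_tangent (\<theta> u)"
  using vderiv_1_eqI[OF bump_deriv] by simp

text \<open>Leaves room for a perturbation of fixed size that keeps the radius positive at all
  angles at once.\<close>

lemma radius_bounded_below: "\<exists>e>0. \<forall>x. e \<le> radius x"
proof -
  have "continuous_on {0..1} (\<lambda>u. radius (\<theta> u))"
    using smooth_curve_has_vderiv[OF smooth_radius, of 0]
    by (intro continuous_at_imp_continuous_on ballI isCont_o2[OF isCont_angle])
       (auto dest: has_vector_derivative_continuous)
  then obtain v where v: "\<forall>u\<in>{0..1}. radius (\<theta> v) \<le> radius (\<theta> u)"
    using continuous_attains_inf[of "{0..1::real}" "\<lambda>u. radius (\<theta> u)"] by auto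
  have per: "radius (\<theta> (u + 1)) = radius (\<theta> u)" for u
    using vderiv_periodic[of c 1, OF smooth period] by (simp add: radius_def turning_def)
  have "radius (\<theta> v) \<le> radius (\<theta> u)" for u
    using range_periodic[of "\<lambda>u. radius (\<theta> u)", OF per] v by (metis (no_types, lifting) image_iff rangeI)
  then show ?thesis
    using radius_pos[of "\<theta> v"] angle_param by metis
qed

text \<open>The velocity of \<open>bump\<close> is a multiple of the unit tangent at \<theta>. So
  \<theta> remains a normal angle of the perturbed curve, the turning does not change, and the radii
  add.\<close>

lemma perturb:
  defines "c' \<equiv> \<lambda>t u. c u + t *\<^sub>R bump u"
  assumes pos: "\<And>x. radius x + t * bump_radius x > 0"
  shows perturb_rosette_angle: "rosette_angle m (c' t) \<theta>"
    and perturb_speed: "norm (vderiv 1 (c' t) u) = (radius (\<theta> u) + t * bump_radius (\<theta> u)) * turning (c' t) u"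
proof -
  have v: "vderiv i (c' t) u = vderiv i c u + t *\<^sub>R vderiv i bump u" for i u
    unfolding c'_def by (rule vderiv_add_scaleR[OF smooth smooth_bump])
  have sm: "smooth_curve (c' t)"
    unfolding c'_def by (intro smooth_curve_add smooth smooth_bump smooth_curve_scaleR smooth_curve_const)
  have v1: "vderiv 1 (c' t) u = ((radius (\<theta> u) + t * bump_radius (\<theta> u)) * turning c u) *\<^sub>R unit_tangent (\<theta> u)" for u
    unfolding v vderiv_1_bump by (subst velocity_eq) (simp only: speed_radius algebra_simps scaleR_scaleR)
  have pos': "(radius (\<theta> u) + t * bump_radius (\<theta> u)) * turning c u > 0" for u
    using pos turning_pos by simp
  have n: "norm (vderiv 1 (c' t) u) = (radius (\<theta> u) + t * bump_radius (\<theta> u)) * turning c u" for u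
    unfolding v1 using pos'[of u] by simp
  have na: "normal_angle (c' t) \<theta>"
    using angle v1 n by (simp add: normal_angle_def unit_tangent_def del: One_nat_def)
  have reg: "vderiv 1 (c' t) u \<noteq> 0" for u using n[of u] pos'[of u] by auto
  have tu: "turning (c' t) u = turning c u" for u
    using DERIV_unique[OF normal_angle_has_real_derivative[OF sm reg na] angle_deriv] .
  have "cross2 (vderiv 1 (c' t) u) (vderiv 2 (c' t) u)
      = turning (c' t) u * (vderiv 1 (c' t) u \<bullet> vderiv 1 (c' t) u)" for u
    using reg[of u] by (simp add: turning_def)
  then have "signed_curvature (c' t) u > 0" for u
    using reg[of u] turning_pos[of u] by (simp add: signed_curvature_eq tu del: One_nat_def)
  moreover have "rotation_number (c' t) (real m)"
    using na angle_period[of 0] by (auto simp: rotation_number_def)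
  moreover have "c' t (u + 1) = c' t u" for u by (simp add: c'_def period bump_period)
  ultimately show "rosette_angle m (c' t) \<theta>"
    using na m reg sm by unfold_locales (auto simp: rosettes_def closed_curves_def)
  show "norm (vderiv 1 (c' t) u) = (radius (\<theta> u) + t * bump_radius (\<theta> u)) * turning (c' t) u"
    by (simp only: n tu)
qed

definition bump_radius' :: "real \<Rightarrow> real" where
  "bump_radius' x = (freq\<^sup>2 - 1) * freq * sin (freq * x)"

lemma bump_radius_deriv: "(bump_radius has_real_derivative bump_radius' x) (at x)"
  unfolding bump_radius_def[abs_def] bump_radius'_def
  by (auto intro!: derivative_eq_intros simp: algebra_simps)

text \<open>This is where the frequency of the perturbation matters: \<open>freq * k\<close> is never an even integer.\<close>

lemma negligible_bump_wronskian:
  assumes "odd k"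
  shows "negligible {x. bump_radius' x * bump_radius (x + real k * pi)
    - bump_radius x * bump_radius' (x + real k * pi) = 0}"
proof -
  define b where "b = freq * (real k * pi) / 2"
  have "sin b \<noteq> 0"
  proof
    assume "sin b = 0"
    then obtain i :: int where "b = of_int i * pi" unfolding sin_zero_iff_int2 by auto
    then have "(freq * real k - 2 * of_int i) * pi = 0" by (simp add: b_def algebra_simps)
    then have "freq * real k = 2 * of_int i" by simp
    then have "(2 * real m + 1) * real k = 2 * real m * of_int i"
      using m by (simp add: freq_def field_simps)
    then have "of_int ((2 * int m + 1) * int k) = (of_int (2 * int m * i) :: real)" by simp
    then have "(2 * int m + 1) * int k = 2 * int m * i" by (simp only: of_int_eq_iff)
    moreover have "odd ((2 * int m + 1) * int k)" using assms by simp
    ultimately show False by simp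
  qed
  have freq: "freq\<^sup>2 > 1" "freq > 0" using freq_gt by (auto simp: one_less_power)
  have "bump_radius' x * bump_radius (x + real k * pi) - bump_radius x * bump_radius' (x + real k * pi)
     = - 2 * (freq\<^sup>2 - 1) * freq * sin b * (cos (freq * x + b) + (1 - freq\<^sup>2) * cos b)" for x
  proof -
    \<comment> \<open>The midpoint of the two phases, which become y - b and y + b.\<close>
    define y where "y = freq * x + b"
    have e: "freq * (x + real k * pi) = y + b" "freq * x = y - b"
      by (simp_all add: b_def y_def algebra_simps)
    have 1: "sin (y - b) - sin (y + b) = - 2 * cos y * sin b"
      by (simp add: sin_add sin_diff)
    have 2: "sin (y - b) * cos (y + b) - cos (y - b) * sin (y + b) = - 2 * sin b * cos b"
      using sin_diff[of "y - b" "y + b"] sin_double[of b] by simp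
    have "bump_radius' x * bump_radius (x + real k * pi) - bump_radius x * bump_radius' (x + real k * pi)
      = (freq\<^sup>2 - 1) * freq * ((sin (y - b) - sin (y + b))
          + (1 - freq\<^sup>2) * (sin (y - b) * cos (y + b) - cos (y - b) * sin (y + b)))"
      unfolding bump_radius_def bump_radius'_def e by (simp add: algebra_simps)
    also have "\<dots> = - 2 * (freq\<^sup>2 - 1) * freq * sin b * (cos y + (1 - freq\<^sup>2) * cos b)"
      unfolding 1 2 by (simp add: algebra_simps)
    finally show ?thesis unfolding y_def .
  qed
  note eq = this
  have nz: "- 2 * (freq\<^sup>2 - 1) * freq * sin b \<noteq> 0" using freq \<open>sin b \<noteq> 0\<close> by simp
  have "bump_radius' x * bump_radius (x + real k * pi) - bump_radius x * bump_radius' (x + real k * pi) = 0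
      \<longleftrightarrow> cos (freq * x + b) + (1 - freq\<^sup>2) * cos b = 0" for x
    unfolding eq by (subst mult_eq_0_iff) (simp only: nz simp_thms)
  also have "cos (freq * x + b) + (1 - freq\<^sup>2) * cos b = 0
      \<longleftrightarrow> cos (freq * x + b) = (freq\<^sup>2 - 1) * cos b" for x
    by (auto simp: algebra_simps)
  finally show ?thesis using negligible_cos_level[of freq b] freq by simp
qed

lemma perturb_dense:
  assumes k: "odd k" and e: "e > 0" and \<epsilon>: "\<epsilon> > 0" and K: "K \<in> lmeasurable"
  shows "\<exists>d\<in>Cinf_nbhd c N e \<inter> rosettes m. measure lebesgue (flat_angles k d \<inter> K) < \<epsilon>"
proof -
  obtain B where B: "B > 0" "\<And>i u. i \<le> N \<Longrightarrow> norm (vderiv i bump u) \<le> B"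
    using bounded_vderiv_periodic[OF smooth_bump bump_period] by metis
  obtain \<delta> where \<delta>: "\<delta> > 0" "\<And>x. \<delta> \<le> radius x" using radius_bounded_below by blast
  define M where "M = 1 + \<bar>1 - freq\<^sup>2\<bar>"
  have M: "\<bar>bump_radius x\<bar> \<le> M" for x
  proof -
    have "\<bar>(1 - freq\<^sup>2) * cos (freq * x)\<bar> \<le> \<bar>1 - freq\<^sup>2\<bar> * 1"
      unfolding abs_mult by (intro mult_left_mono) auto
    then have "\<bar>1\<bar> + \<bar>(1 - freq\<^sup>2) * cos (freq * x)\<bar> \<le> M" by (simp add: M_def)
    then show ?thesis unfolding bump_radius_def by (rule order_trans[OF abs_triangle_ineq])
  qed
  have "M > 0" by (simp add: M_def add_pos_nonneg)
  \<comment> \<open>For parameters up to \<tau> the first bound keeps the curve in the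
    neighbourhood, the second keeps its radius positive; the factors 2 make both inequalities
    strict.\<close>
  define \<tau> where "\<tau> = min (e / (2 * B)) (\<delta> / (2 * M))"
  have \<tau>: "\<tau> > 0" "\<tau> * B < e" "\<tau> * M < \<delta>"
  proof -
    show "\<tau> > 0" using e B(1) \<delta>(1) \<open>M > 0\<close> by (simp add: \<tau>_def)
    have "\<tau> * B \<le> e / (2 * B) * B" using B(1) by (intro mult_right_mono) (auto simp: \<tau>_def)
    then show "\<tau> * B < e" using e B(1) by simp
    have "\<tau> * M \<le> \<delta> / (2 * M) * M" using \<open>M > 0\<close> by (intro mult_right_mono) (auto simp: \<tau>_def)
    then show "\<tau> * M < \<delta>" using \<delta>(1) \<open>M > 0\<close> by simp
  qed
  \<comment> \<open>Infinitely many distinct parameters in (0, \<tau>]; their zero sets can overlap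
    only finitely often at almost every angle.\<close>
  define t where "t j = \<tau> / real (Suc j)" for j
  have t: "0 < t j" "t j \<le> \<tau>" for j using \<tau>(1) by (auto simp: t_def field_simps)
  have inj: "inj t" using \<tau>(1) by (auto simp: inj_def t_def)
  define d where "d j u = c u + t j *\<^sub>R bump u" for j u
  have pos: "radius x + t j * bump_radius x > 0" for j x
  proof -
    have "\<bar>t j * bump_radius x\<bar> \<le> \<tau> * M"
      unfolding abs_mult using t[of j] M[of x] by (intro mult_mono) auto
    then show ?thesis using \<tau>(3) \<delta>(2)[of x] by linarith
  qed
  have ra: "rosette_angle m (d j) \<theta>" for j
    using perturb_rosette_angle[OF pos, of j] by (simp add: d_def[abs_def])
  let ?W = "{x. bump_radius' x * bump_radius (x + real k * pi) - bump_radius x * bump_radius' (x + real k * pi) = 0}"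
  \<comment> \<open>The translation is there because \<open>flat_angles\<close> counts from \<theta>
    0.\<close>
  have "negligible ((+) (- \<theta> 0) ` ?W)"
    by (intro negligible_translation negligible_bump_wronskian k)
  moreover have "{x \<in> K. \<forall>i. \<exists>j\<ge>i. x \<in> flat_angles k (d j)} \<subseteq> (+) (- \<theta> 0) ` ?W"
  proof (rule subsetI, rule ccontr)
    fix x assume x: "x \<in> {x \<in> K. \<forall>i. \<exists>j\<ge>i. x \<in> flat_angles k (d j)}"
      and "x \<notin> (+) (- \<theta> 0) ` ?W"
    define y z where "y = \<theta> 0 + x" and "z = \<theta> 0 + x + real k * pi"
    have "y \<notin> ?W" using \<open>x \<notin> _\<close> by (force simp: y_def image_iff)
    then have a: "bump_radius' y * bump_radius z - bump_radius y * bump_radius' z \<noteq> 0"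
      by (simp add: y_def z_def)
    \<comment> \<open>The lower coefficients, in t, of the Wronskian of radius + t
      \<open>bump_radius\<close> and its translate by k \<pi>.\<close>
    define a1 a0 where "a1 = vderiv 1 radius y * bump_radius z + bump_radius' y * radius z
        - radius y * bump_radius' z - bump_radius y * vderiv 1 radius z"
      and "a0 = vderiv 1 radius y * radius z - radius y * vderiv 1 radius z"
    have "t j \<in> {t. a0 + t * a1 + t\<^sup>2 * (bump_radius' y * bump_radius z - bump_radius y * bump_radius' z) = 0}"
      if "x \<in> flat_angles k (d j)" for j
    proof -
      interpret d: rosette_angle m "d j" \<theta> by (rule ra)
      have r: "(radius has_real_derivative vderiv 1 radius x) (at x)" for x
        using smooth_curve_has_vderiv[OF smooth_radius, of 0 x]
        by (simp add: has_real_derivative_iff_has_vector_derivative)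
      have "((\<lambda>x. radius x + t j * bump_radius x) has_real_derivative vderiv 1 radius x + t j * bump_radius' x) (at x)" for x
        by (intro DERIV_add r DERIV_cmult bump_radius_deriv)
      moreover have "norm (vderiv 1 (d j) u) = (radius (\<theta> u) + t j * bump_radius (\<theta> u)) * turning (d j) u" for u
        using perturb_speed[OF pos, of j u] by (simp add: d_def[abs_def])
      ultimately have "(vderiv 1 radius y + t j * bump_radius' y) * (radius z + t j * bump_radius z)
          - (radius y + t j * bump_radius y) * (vderiv 1 radius z + t j * bump_radius' z) = 0"
        using that d.flat_angles_eq[of "\<lambda>x. radius x + t j * bump_radius x"
            "\<lambda>x. vderiv 1 radius x + t j * bump_radius' x" k] by (simp add: y_def z_def)
      then show ?thesis
        unfolding a0_def a1_def by (simp add: algebra_simps power2_eq_square)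
    qed
    then have "{j. x \<in> flat_angles k (d j)} \<subseteq> t -` {t. a0 + t * a1 + t\<^sup>2 * (bump_radius' y * bump_radius z - bump_radius y * bump_radius' z) = 0}"
      by blast
    then have "finite {j. x \<in> flat_angles k (d j)}"
      by (rule finite_subset) (intro finite_vimageI finite_quadratic_roots a inj)
    then show False
      using x by (auto simp: finite_nat_set_iff_bounded) (metis leD)
  qed
  ultimately obtain j where j: "measure lebesgue (flat_angles k (d j) \<inter> K) < \<epsilon>"
    using measure_limsup_less[of "\<lambda>j. flat_angles k (d j)" K "(+) (- \<theta> 0) ` ?W" \<epsilon>] K \<epsilon>
      rosette_angle.flat_angles_closed[OF ra]
    by (auto simp: negligible_imp_measurable negligible_imp_measure0)
  have "d j \<in> rosettes m" using rosette_angle.rosette[OF ra] .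
  moreover have "norm (vderiv i (d j) u - vderiv i c u) < e" if "i \<le> N" for i u
  proof -
    have "norm (vderiv i (d j) u - vderiv i c u) = t j * norm (vderiv i bump u)"
      using t(1)[of j] by (simp add: d_def[abs_def] vderiv_add_scaleR[OF smooth smooth_bump])
    also have "\<dots> \<le> \<tau> * B" using t[of j] B(2)[OF that] B(1) \<tau>(1) by (intro mult_mono) auto
    finally show ?thesis using \<tau>(2) by simp
  qed
  ultimately show ?thesis
    using j by (intro bexI[of _ "d j"]) (auto simp: Cinf_nbhd_def rosettes_def)
qed

end

section \<open>Open dense sets of rosettes and the residual set\<close>

lemma rosette_normal_angle: "c \<in> rosettes m \<Longrightarrow> \<exists>\<theta>. normal_angle c \<theta>"
  by (auto simp: rosettes_def rotation_number_def)

lemma topspace_rosette_space: "topspace (rosette_space m) = rosettes m"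
proof -
  have "Cinf_open closed_curves"
    unfolding Cinf_open_def by (auto simp: Cinf_nbhd_def intro!: exI[of _ 1])
  moreover have "U \<subseteq> closed_curves" if "Cinf_open U" for U
    using that by (simp add: Cinf_open_def)
  ultimately have "topspace Cinf_topology = closed_curves"
    unfolding topspace_def openin_Cinf_topology by blast
  then show ?thesis by (auto simp: rosette_space_def rosettes_def)
qed

text \<open>The ambient open set V consists of all closed curves, rosettes or not, with a
  neighbourhood whose rosettes lie in U. Halving the radius of the neighbourhood shows that V is
  open.\<close>

lemma openin_rosette_spaceI:
  assumes U: "U \<subseteq> rosettes m"
    and nbhd: "\<And>c. c \<in> U \<Longrightarrow> \<exists>N. \<exists>e>0. Cinf_nbhd c N e \<inter> rosettes m \<subseteq> U"
  shows "openin (rosette_space m) U"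
proof -
  define V where "V = {c \<in> closed_curves. \<exists>N. \<exists>e>0. Cinf_nbhd c N e \<inter> rosettes m \<subseteq> U}"
  have "Cinf_open V"
    unfolding Cinf_open_def
  proof (intro conjI ballI)
    show "V \<subseteq> closed_curves" by (auto simp: V_def)
    fix c assume "c \<in> V"
    then obtain N e where e: "e > 0" "Cinf_nbhd c N e \<inter> rosettes m \<subseteq> U" by (auto simp: V_def)
    have "d \<in> V" if d: "d \<in> Cinf_nbhd c N (e / 2)" for d
    proof -
      have "norm (vderiv j b t - vderiv j c t) < e"
        if "norm (vderiv j b t - vderiv j d t) < e / 2" "j \<le> N" for b j t
      proof -
        have "norm (vderiv j d t - vderiv j c t) < e / 2" using d that(2) by (simp add: Cinf_nbhd_def)
        then show ?thesis
          using that(1) norm_triangle_ineq[of "vderiv j b t - vderiv j d t" "vderiv j d t - vderiv j c t"]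
          by simp
      qed
      then have "Cinf_nbhd d N (e / 2) \<subseteq> Cinf_nbhd c N e" by (auto simp: Cinf_nbhd_def)
      then show ?thesis
        using e d unfolding V_def by (auto simp: Cinf_nbhd_def intro!: exI[of _ N] exI[of _ "e / 2"])
    qed
    then show "\<exists>N. \<exists>e>0. Cinf_nbhd c N e \<subseteq> V"
      using e(1) by (intro exI[of _ N] exI[of _ "e / 2"]) auto
  qed
  moreover have "U = V \<inter> rosettes m"
  proof
    show "U \<subseteq> V \<inter> rosettes m" using U nbhd by (auto simp: V_def rosettes_def)
    show "V \<inter> rosettes m \<subseteq> U"
    proof
      fix c assume c: "c \<in> V \<inter> rosettes m"
      then obtain N e where e: "e > 0" "Cinf_nbhd c N e \<inter> rosettes m \<subseteq> U" by (auto simp: V_def)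
      moreover have "c \<in> Cinf_nbhd c N e" using c e(1) by (auto simp: V_def Cinf_nbhd_def)
      ultimately show "c \<in> U" using c by blast
    qed
  qed
  ultimately show ?thesis
    unfolding rosette_space_def openin_subtopology openin_Cinf_topology by blast
qed

text \<open>One index controls both window and tolerance: a curve in all these sets satisfies, on a
  fixed window, the bounds of all larger windows, and these tend to 0.\<close>

definition nearly_generic :: "nat \<Rightarrow> nat \<Rightarrow> nat \<Rightarrow> (real \<Rightarrow> real^2) set" where
  "nearly_generic m k n = {c \<in> rosettes m.
     measure lebesgue (flat_angles k c \<inter> {- real n..real n}) < 1 / real (Suc n)}"

lemma flat_angles_sets:
  assumes "m \<ge> 1" "c \<in> rosettes m"
  shows "flat_angles k c \<in> sets lebesgue"
proof -
  obtain \<theta> where "normal_angle c \<theta>" using rosette_normal_angle assms(2) by blast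
  then interpret rosette_angle m c \<theta> using assms by unfold_locales
  show ?thesis by (simp add: flat_angles_closed)
qed

lemma openin_nearly_generic:
  assumes m: "m \<ge> 1"
  shows "openin (rosette_space m) (nearly_generic m k n)"
proof (rule openin_rosette_spaceI)
  show "nearly_generic m k n \<subseteq> rosettes m" by (auto simp: nearly_generic_def)
  fix c assume c: "c \<in> nearly_generic m k n"
  then have cm: "c \<in> rosettes m" by (simp add: nearly_generic_def)
  let ?K = "{- real n..real n}"
  show "\<exists>N. \<exists>e>0. Cinf_nbhd c N e \<inter> rosettes m \<subseteq> nearly_generic m k n"
  proof (rule ccontr)
    assume "\<not> ?thesis"
    \<comment> \<open>Order 3 is the highest derivative in \<open>log_rate\<close>; the shrinking
      radii make the counterexamples converge to c.\<close>
    then have "\<exists>d. d \<in> Cinf_nbhd c 3 (1 / real (Suc j)) \<inter> rosettes m \<and> d \<notin> nearly_generic m k n" for j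
      by (metis (no_types, lifting) of_nat_0_less_iff subsetI zero_less_Suc zero_less_divide_1_iff)
    then obtain d where d: "\<And>j. d j \<in> Cinf_nbhd c 3 (1 / real (Suc j))" "\<And>j. d j \<in> rosettes m"
      "\<And>j. d j \<notin> nearly_generic m k n"
      by (metis IntD1 IntD2)
    obtain \<theta> where \<theta>: "normal_angle c \<theta>" using rosette_normal_angle[OF cm] by blast
    obtain \<phi> where \<phi>: "\<And>j. normal_angle (d j) (\<phi> j)" using rosette_normal_angle[OF d(2)] by metis
    interpret rosette_angle m c \<theta> using m cm \<theta> by unfold_locales
    interpret rosette_limit m c \<theta> d \<phi>
    proof (intro rosette_limit.intro rosette_limit_axioms.intro rosette_angle_axioms)
      show "rosette_angle m (d j) (\<phi> j)" for j using m d(2) \<phi> by unfold_locales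
      show "norm (vderiv i (d j) t - vderiv i c t) < 1 / real (Suc j)" if "i \<le> 3" for i j t
        using d(1)[of j] that by (simp add: Cinf_nbhd_def)
    qed
    have "\<exists>j. measure lebesgue (flat_angles k (d j) \<inter> ?K) < 1 / real (Suc n)"
    proof (rule measure_limsup_less[where B = "flat_angles k c \<inter> ?K"])
      show "flat_angles k (d j) \<in> sets lebesgue" for j by (rule flat_angles_sets[OF m d(2)])
      show "flat_angles k c \<inter> ?K \<in> lmeasurable"
        by (intro lmeasurable_compact closed_Int_compact flat_angles_closed) auto
      show "{x \<in> ?K. \<forall>i. \<exists>j\<ge>i. x \<in> flat_angles k (d j)} \<subseteq> flat_angles k c \<inter> ?K"
        using limsup_flat_angles by blast
      show "measure lebesgue (flat_angles k c \<inter> ?K) < 1 / real (Suc n)"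
        using c by (simp add: nearly_generic_def)
    qed auto
    then show False using d(2,3) by (auto simp: nearly_generic_def)
  qed
qed

lemma dense_nearly_generic:
  assumes m: "m \<ge> 1" and k: "odd k"
  shows "rosette_space m closure_of nearly_generic m k n = topspace (rosette_space m)"
proof (rule antisym[OF closure_of_subset_topspace], rule subsetI)
  fix c assume c: "c \<in> topspace (rosette_space m)"
  then have cm: "c \<in> rosettes m" by (simp add: topspace_rosette_space)
  obtain \<theta> where \<theta>: "normal_angle c \<theta>" using rosette_normal_angle[OF cm] by blast
  interpret rosette_angle m c \<theta> using m cm \<theta> by unfold_locales
  have "\<exists>y. y \<in> nearly_generic m k n \<and> y \<in> T" if T: "c \<in> T" "openin (rosette_space m) T" for T
  proof -
    obtain V where V: "Cinf_open V" "T = V \<inter> rosettes m"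
      using T(2) by (auto simp: rosette_space_def openin_subtopology openin_Cinf_topology)
    then obtain N e where e: "e > 0" "Cinf_nbhd c N e \<subseteq> V"
      using T(1) unfolding Cinf_open_def by blast
    have "0 < 1 / real (Suc n)" by simp
    from perturb_dense[OF k e(1) this, of "{- real n..real n}" N]
    show ?thesis using e(2) V(2) by (fastforce simp: nearly_generic_def)
  qed
  then show "c \<in> rosette_space m closure_of nearly_generic m k n"
    using c by (simp add: in_closure_of)
qed

lemma residual_flat_angles:
  assumes m: "m \<ge> 1" and k: "odd k"
  shows "residual_in (rosette_space m) {c \<in> rosettes m. negligible (flat_angles k c)}"
  unfolding residual_in_def
proof (intro conjI exI[of _ "nearly_generic m k"] allI)
  show "{c \<in> rosettes m. negligible (flat_angles k c)} \<subseteq> topspace (rosette_space m)"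
    by (auto simp: topspace_rosette_space)
  show "openin (rosette_space m) (nearly_generic m k n)" for n by (rule openin_nearly_generic[OF m])
  show "rosette_space m closure_of nearly_generic m k n = topspace (rosette_space m)" for n
    by (rule dense_nearly_generic[OF m k])
  show "(\<Inter>n. nearly_generic m k n) \<subseteq> {c \<in> rosettes m. negligible (flat_angles k c)}"
  proof
    fix c assume c: "c \<in> (\<Inter>n. nearly_generic m k n)"
    then have cm: "c \<in> rosettes m" by (auto simp: nearly_generic_def)
    let ?F = "\<lambda>n::nat. flat_angles k c \<inter> {- real n..real n}"
    have lm: "?F n \<in> lmeasurable" for n
      by (rule fmeasurableI2[of "{- real n..real n}"])
         (use flat_angles_sets[OF m cm, of k] in auto)
    have "negligible (?F N)" for N
    proof -
      have "measure lebesgue (?F N) \<le> 0"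
      proof (rule field_le_epsilon)
        fix e :: real assume "e > 0"
        then obtain n where n: "1 / real (Suc n) < e" using nat_approx_posE by blast
        have "measure lebesgue (?F N) \<le> measure lebesgue (?F (max N n))"
          using lm by (intro measure_mono_fmeasurable) auto
        also have "\<dots> < 1 / real (Suc (max N n))"
          using c by (auto simp: nearly_generic_def)
        also have "\<dots> \<le> 1 / real (Suc n)" by (intro divide_left_mono) auto
        finally show "measure lebesgue (?F N) \<le> 0 + e" using n by simp
      qed
      then show ?thesis using lm[of N] by (simp add: negligible_iff_measure measure_le_0_iff)
    qed
    then have "negligible (\<Union>n. ?F n)" by (rule negligible_Union_nat)
    moreover have "flat_angles k c \<subseteq> (\<Union>n. ?F n)"
    proof
      fix x assume "x \<in> flat_angles k c"
      moreover obtain n where "\<bar>x\<bar> \<le> real n" using real_arch_simple by blast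
      ultimately show "x \<in> (\<Union>n. ?F n)" by (auto intro!: exI[of _ n])
    qed
    ultimately show "c \<in> {c \<in> rosettes m. negligible (flat_angles k c)}"
      using cm negligible_subset by blast
  qed
qed

text \<open>Both curves are parametrized by \<theta> over one period, with
  \<open>arc_density\<close> in place of d\<tau>. Absolute integrability is part of the conclusion
  because \<open>integral\<close> is 0 for a function that is not integrable.\<close>

theorem theorem5p18:
  fixes m k :: nat
  assumes "m \<ge> 1" and "odd k" and "1 \<le> k" and "k \<le> m"
  shows "generically (rosette_space m) (\<lambda>c. \<forall>p. support_function c p \<longrightarrow>
    (let f = wave_front k p;
         \<nu> = front_normal k p;
         \<sigma> = singular_curve k p;
         \<beta> = boundary_curve;
         period = {0 .. 2 * real m * pi};
         singular_part = (\<lambda>t. singular_curvature f \<nu> \<sigma> t * arc_density f \<sigma> t);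
         boundary_part = (\<lambda>t. geodesic_curvature f \<nu> \<beta> t * arc_density f \<beta> t)
     in singular_part absolutely_integrable_on period \<and>
        boundary_part absolutely_integrable_on period \<and>
        integral period singular_part + integral period boundary_part = 0))"
  unfolding generically_def
proof (intro exI[of _ "{c \<in> rosettes m. negligible (flat_angles k c)}"] conjI ballI allI impI)
  show "residual_in (rosette_space m) {c \<in> rosettes m. negligible (flat_angles k c)}"
    by (rule residual_flat_angles[OF assms(1,2)])
  fix c p
  assume c: "c \<in> {c \<in> rosettes m. negligible (flat_angles k c)}" and "support_function c p"
  then obtain \<theta> where \<theta>: "normal_angle c \<theta>" and supp: "\<And>t. p (\<theta> t) = c t \<bullet> unit_normal (\<theta> t)"
    by (auto simp: support_function_def unit_normal_def)
  interpret rosette_angle m c \<theta> using assms(1) c \<theta> by unfold_locales auto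
  have r: "(vderiv i radius has_real_derivative vderiv (Suc i) radius x) (at x)" for i x
    unfolding has_real_derivative_iff_has_vector_derivative by (rule smooth_curve_has_vderiv[OF smooth_radius])
  interpret front_data k p "\<lambda>x. c (param x) \<bullet> unit_tangent x" radius "vderiv 1 radius" "vderiv 2 radius"
    using assms(2) support_deriv[of p, OF supp] support_deriv2[of p, OF supp] r[of 0] r[of 1] radius_pos
    by unfold_locales (simp_all add: numeral_2_eq_2)
  \<comment> \<open>The zeros of \<mu> are those of the Wronskian of \<open>radius\<close>, so a
    condition on c alone handles every support function p of c; the shift by \<theta> 0 undoes the
    normalization in \<open>flat_angles\<close>.\<close>
  have "{x. \<mu> x = 0} \<subseteq> (+) (\<theta> 0) ` flat_angles k c"
  proof
    fix x assume "x \<in> {x. \<mu> x = 0}"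
    then have "vderiv 1 radius (x + s) * radius x - radius (x + s) * vderiv 1 radius x = 0"
      unfolding \<mu>_def using S_pos[of x] by simp
    then have "x - \<theta> 0 \<in> flat_angles k c"
      unfolding flat_angles_eq[OF speed_radius r[of 0, unfolded vderiv_0]]
      by (simp add: s_def mult.commute)
    then show "x \<in> (+) (\<theta> 0) ` flat_angles k c" by (rule rev_image_eqI) simp
  qed
  moreover have "negligible ((+) (\<theta> 0) ` flat_angles k c)"
    using c by (intro negligible_translation) simp
  ultimately have "negligible {x. \<mu> x = 0}"
    by (metis negligible_subset)
  then have "negligible {x \<in> {0..2 * real m * pi}. \<mu> x = 0}"
    by (rule negligible_subset) auto
  moreover have "p (x + 2 * real m * pi) = p x" for x
    using support_period[of p, OF supp, of x] by (simp add: mult_ac)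
  ultimately show "let f = wave_front k p;
         \<nu> = front_normal k p;
         \<sigma> = singular_curve k p;
         \<beta> = boundary_curve;
         period = {0 .. 2 * real m * pi};
         singular_part = (\<lambda>t. singular_curvature f \<nu> \<sigma> t * arc_density f \<sigma> t);
         boundary_part = (\<lambda>t. geodesic_curvature f \<nu> \<beta> t * arc_density f \<beta> t)
     in singular_part absolutely_integrable_on period \<and>
        boundary_part absolutely_integrable_on period \<and>
        integral period singular_part + integral period boundary_part = 0"
    unfolding Let_def by (intro conjI gauss_bonnet) auto
qed

end
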